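(* Let $k \geq 0$ be an integer and let $\widetilde{f}_{1,6k+2}$ be the normalized extremal quasimodular form of weight $6k+2$ and depth $1$. Then every Fourier coefficient of $\widetilde{f}_{1,6k+2}$ (in its expansion in powers of $q$) lies in the ring $\mathbb{Z}\big[\frac{1}{p} : p \text{ prime},\ p < 6k+2\big]$, i.e. $\widetilde{f}_{1,6k+2} \in \mathbb{Z}\big[\frac{1}{p} : p < 6k+2\big][[q]]$.
   Context: Let $\mathbb{H}$ be the upper half-plane, $z\in\mathbb{H}$, $q=e^{2\pi i z}$, $\sigma_j(n)=\sum_{d\mid n}d^j$. The Eisenstein series are $E_2=1-24\sum_{n\ge1}\sigma_1(n)q^n$, $E_4=1+240\sum_{n\ge1}\sigma_3(n)q^n$, $E_6=1-504\sum_{n\ge1}\sigma_5(n)q^n$. For an integer $w$, $\mathrm{M}_w$ denotes the space of holomorphic modular forms of weight $w$ for $\mathrm{SL}_2(\mathbb{Z})$ (with $\mathrm{M}_w=\{0\}$ for $w<0$). For even $w\ge 0$ let $\widetilde{\mathrm{M}}_{1,w}=\{f_0+f_1E_2 : f_0\in \mathrm{M}_w,\ f_1\in\mathrm{M}_{w-2}\}$; an element $f_0+f_1E_2$ with $f_1\neq 0$ is a quasimodular form of weight $w$ and depth $1$. Let $m=\dim_{\mathbb{C}}\widetilde{\mathrm{M}}_{1,w}$. A quasimodular form $f=\sum_{n\ge0}a_nq^n$ of weight $w$ and depth exactly $1$ is called extremal if $a_0=\dots=a_{m-2}=0$ and $a_{m-1}\neq0$, and normalized extremal if moreover $a_{m-1}=1$;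 such a form is unique when it exists and is denoted $\widetilde{f}_{1,w}$. For a bound $N$, $\mathbb{Z}[\frac1p : p<N]$ denotes the subring of $\mathbb{Q}$ generated by $\mathbb{Z}$ and the inverses of all primes $p<N$. *)

theory Defs
  imports "HOL-Analysis.Analysis" "HOL-Library.Function_Algebras"
    "HOL-Computational_Algebra.Primes"
begin

definition upper_half_plane :: "complex set" where
  "upper_half_plane = {z. Im z > 0}"

definition q_param :: "complex \<Rightarrow> complex" where
  "q_param z = exp (2 * of_real pi * \<i> * z)"

definition has_q_expansion :: "(complex \<Rightarrow> complex) \<Rightarrow> (nat \<Rightarrow> complex) \<Rightarrow> bool" where
  "has_q_expansion f a \<longleftrightarrow> (\<forall>z\<in>upper_half_plane. (\<lambda>n. a n * q_param z ^ n) sums f z)"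

definition divisor_power_sum :: "nat \<Rightarrow> nat \<Rightarrow> nat" where
  "divisor_power_sum j n = (\<Sum>d | d dvd n. d ^ j)"

text \<open>
  Functions on the upper half-plane are represented by functions on \<open>complex\<close> that vanish
  elsewhere, so that equality and linear (in)dependence have their usual meaning.
\<close>

definition Eisenstein_E2 :: "complex \<Rightarrow> complex" where
  "Eisenstein_E2 z =
     (if z \<in> upper_half_plane
      then 1 - 24 * (\<Sum>n. of_nat (divisor_power_sum 1 (Suc n)) * q_param z ^ Suc n)
      else 0)"

text \<open>
  Holomorphy at the cusp is expressed as the existence of an expansion in non-negative
  powers of \<open>q\<close>.
\<close>

definition modular_forms :: "int \<Rightarrow> (complex \<Rightarrow> complex) set" where
  "modular_forms w =
     {f. f holomorphic_on upper_half_plane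
       \<and> (\<forall>z. z \<notin> upper_half_plane \<longrightarrow> f z = 0)
       \<and> (\<forall>a b c d :: int. a * d - b * c = 1 \<longrightarrow>
            (\<forall>z\<in>upper_half_plane.
               f ((of_int a * z + of_int b) / (of_int c * z + of_int d))
                 = (of_int c * z + of_int d) powi w * f z))
       \<and> (\<exists>a. has_q_expansion f a)}"

definition quasimodular_forms_depth_le_1 :: "int \<Rightarrow> (complex \<Rightarrow> complex) set" where
  "quasimodular_forms_depth_le_1 w =
     {(\<lambda>z. f0 z + f1 z * Eisenstein_E2 z) | f0 f1.
        f0 \<in> modular_forms w \<and> f1 \<in> modular_forms (w - 2)}"

definition quasimodular_forms_depth_1 :: "int \<Rightarrow> (complex \<Rightarrow> complex) set" where
  "quasimodular_forms_depth_1 w =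
     {(\<lambda>z. f0 z + f1 z * Eisenstein_E2 z) | f0 f1.
        f0 \<in> modular_forms w \<and> f1 \<in> modular_forms (w - 2) \<and> f1 \<noteq> (\<lambda>z. 0)}"

interpretation complex_fun:
  vector_space "\<lambda>(c::complex) (f::complex \<Rightarrow> complex) z. c * f z"
  by unfold_locales (auto simp: fun_eq_iff algebra_simps)

definition quasimodular_dim :: "int \<Rightarrow> nat" where
  "quasimodular_dim w = complex_fun.dim (quasimodular_forms_depth_le_1 w)"

definition extremal_quasimodular :: "int \<Rightarrow> (complex \<Rightarrow> complex) \<Rightarrow> bool" where
  "extremal_quasimodular w f \<longleftrightarrow>
     f \<in> quasimodular_forms_depth_1 w
     \<and> (\<exists>a. has_q_expansion f a
          \<and> (\<forall>n < quasimodular_dim w - 1. a n = 0)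
          \<and> a (quasimodular_dim w - 1) \<noteq> 0)"

definition normalized_extremal_quasimodular :: "int \<Rightarrow> (complex \<Rightarrow> complex) \<Rightarrow> bool" where
  "normalized_extremal_quasimodular w f \<longleftrightarrow>
     extremal_quasimodular w f
     \<and> (\<exists>a. has_q_expansion f a \<and> a (quasimodular_dim w - 1) = 1)"

inductive_set ints_adjoin_prime_inverses :: "nat \<Rightarrow> rat set" for N :: nat where
  of_int: "of_int i \<in> ints_adjoin_prime_inverses N"
| inverse_prime: "prime p \<Longrightarrow> p < N \<Longrightarrow> inverse (of_nat p) \<in> ints_adjoin_prime_inverses N"
| add: "x \<in> ints_adjoin_prime_inverses N \<Longrightarrow> y \<in> ints_adjoin_prime_inverses N \<Longrightarrow>
    x + y \<in> ints_adjoin_prime_inverses N"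
| mult: "x \<in> ints_adjoin_prime_inverses N \<Longrightarrow> y \<in> ints_adjoin_prime_inverses N \<Longrightarrow>
    x * y \<in> ints_adjoin_prime_inverses N"

end

theory Submission
  imports Defs "HOL-Complex_Analysis.Complex_Analysis"
begin

text \<open>
  Write \<open>P, Q, R\<close> for the \<open>q\<close>-expansions of \<open>E\<^sub>2, E\<^sub>4, E\<^sub>6\<close> and \<open>\<Delta> = (Q\<^sup>3 - R\<^sup>2) / 1728\<close>. The series
  \<open>f\<^sub>0 = P\<close>, \<open>f\<^sub>1 = (Q\<^sup>2 - P R) / 1008\<close>, \<open>f\<^bsub>k+1\<^esub> = (R f\<^sub>k - \<Delta> f\<^bsub>k-1\<^esub>) / \<lambda>\<^sub>k\<close> with
  \<open>\<lambda>\<^sub>k = - 12 (6k - 1) (6k + 7) / (k (k + 1))\<close> are quasimodular of weight \<open>6k + 2\<close> and depth at most 1, and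
  their coefficients only have denominators composed of primes below the weight. Ramanujan's
  equations give, by induction, a first-order differential relation between \<open>f\<^sub>k\<close> and \<open>f\<^bsub>k-1\<^esub>\<close> that yields
  the first two coefficients of \<open>f\<^sub>k\<close>; in particular \<open>f\<^sub>k = q\<^sup>k + O(q\<^bsup>k+1\<^esup>)\<close>. Conversely a form of this
  type vanishing to order \<open>k + 1\<close> is zero, because a Wronskian-like modular form of weight \<open>12k + 4\<close>
  built from it vanishes to order \<open>k + 1\<close>. Hence the products \<open>R\<^bsup>k-j\<^esup> f\<^sub>j\<close> form a basis, the dimension is \<open>k + 1\<close>,
  and \<open>f\<^sub>k\<close> is the normalized extremal form.
\<close>

section \<open>Partial fractions of the cotangent\<close>

text \<open>The obstacle is the normalization. In \<open>R f_(k+1) - Delta f_k\<close> the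
  coefficients of q^(k+1) cancel by themselves, but that of q^(k+2) depends on the second
  coefficients of both forms, whose own recursion would involve third coefficients, and so on. A
  differential relation breaks this chain: q d/dq multiplies the coefficient of q^n by n, so
  comparing adjacent coefficients expresses the second coefficient of a form through that of its
  predecessor. This explains the closed form of the recursion constant, and with it the bound on the
  primes: the largest factor 6k + 7 of its numerator is one less than the weight 6k + 8 of the form
  being constructed. The analytic input is the behaviour of E_2 under z -> -1/z, derived from
  lattice sums, and a bound on the order of vanishing at the cusp.\<close>

lemma Im_minus_inverse_pos: "Im z > 0 \<Longrightarrow> Im (- 1 / z) > 0"
  by (auto simp: Im_divide divide_neg_pos add_nonneg_pos sum_power2_gt_zero_iff complex_eq_iff)

lemma not_Ints_imp_not_nonpos_Ints:
  fixes z :: complex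
  assumes "z \<notin> \<int>"
  shows "z \<notin> \<int>\<^sub>\<le>\<^sub>0" "1 - z \<notin> \<int>\<^sub>\<le>\<^sub>0"
  using assms by (metis nonpos_Ints_subset_Ints subsetD,
      metis Ints_1 Ints_diff diff_add_cancel add_diff_cancel_left' nonpos_Ints_subset_Ints subsetD)

text \<open>\<open>rGamma z * rGamma (1 - z)\<close> is the entire function sin(pi z) / pi;
  differentiating both descriptions and dividing gives the logarithmic derivative.\<close>

lemma Digamma_reflection_complex:
  fixes z :: complex
  assumes "z \<notin> \<int>"
  shows "Digamma (1 - z) - Digamma z = of_real pi * cot (of_real pi * z)"
proof -
  have z: "z \<notin> \<int>\<^sub>\<le>\<^sub>0" "1 - z \<notin> \<int>\<^sub>\<le>\<^sub>0"
    by (rule not_Ints_imp_not_nonpos_Ints[OF assms])+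
  have "((\<lambda>z. rGamma z * rGamma (1 - z)) has_field_derivative
      -rGamma z * Digamma z * rGamma (1 - z) + rGamma z * (rGamma (1 - z) * Digamma (1 - z))) (at z)"
    using z by (auto intro!: derivative_eq_intros)
  moreover have "((\<lambda>z. rGamma z * rGamma (1 - z)) has_field_derivative cos (of_real pi * z)) (at z)"
    unfolding rGamma_reflection_complex by (auto intro!: derivative_eq_intros)
  ultimately have eq: "rGamma z * rGamma (1 - z) * (Digamma (1 - z) - Digamma z) = cos (of_real pi * z)"
    using DERIV_unique by (fastforce simp: algebra_simps)
  have "rGamma z * rGamma (1 - z) \<noteq> 0"
    using z by (simp add: rGamma_eq_zero_iff)
  hence "sin (of_real pi * z) \<noteq> 0" unfolding rGamma_reflection_complex by auto
  with eq show ?thesis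
    unfolding rGamma_reflection_complex by (simp add: cot_def field_simps)
qed

lemma cot_partial_fractions:
  fixes z :: complex
  assumes z: "z \<notin> \<int>"
  shows "(\<lambda>n. 1 / (z + of_nat (Suc n)) + 1 / (z - of_nat (Suc n))) sums
           (of_real pi * cot (of_real pi * z) - 1 / z)"
proof -
  have nz: "z \<noteq> 0" "1 - z \<noteq> 0" using z by (auto)
  have nk: "z + of_nat k \<noteq> 0" "z - of_nat k \<noteq> 0" for k
    using z by (metis Ints_0 Ints_diff Ints_of_nat add_diff_cancel_right', metis Ints_of_nat eq_iff_diff_eq_0)
  have 1: "(\<lambda>k. inverse (z + of_nat k) - inverse (1 - z + of_nat k)) sums (Digamma (1 - z) - Digamma z)"
    using sums_diff[OF summable_sums[OF summable_Digamma[OF nz(2)]] summable_sums[OF summable_Digamma[OF nz(1)]]]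
    by (simp add: Digamma_def)
  \<comment> \<open>The Digamma series pairs 1/(z + k) with 1/(z - k - 1); this telescoping series
    shifts the first member by one, which makes the pairing symmetric and subtracts 1/z.\<close>
  have 2: "(\<lambda>k. inverse (z + of_nat (Suc k)) - inverse (z + of_nat k)) sums (0 - inverse (z + of_nat 0))"
    by (intro telescope_sums filterlim_compose[OF tendsto_inverse_0]
        tendsto_add_filterlim_at_infinity[OF tendsto_const] tendsto_of_nat)
  have "inverse (1 - z + of_nat k) = - (1 / (z - of_nat (Suc k)))" for k
  proof -
    have "1 - z + of_nat k = - (z - of_nat (Suc k))" by simp
    thus ?thesis by (metis inverse_eq_divide inverse_minus_eq)
  qed
  with sums_add[OF 1 2] show ?thesis
    using Digamma_reflection_complex[OF z] by (simp add: inverse_eq_divide algebra_simps)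
qed

lemma Polygamma_1_reflection_complex:
  fixes z :: complex
  assumes "z \<notin> \<int>"
  shows "Polygamma 1 z + Polygamma 1 (1 - z) = of_real pi ^ 2 / sin (of_real pi * z) ^ 2"
proof -
  have z: "z \<notin> \<int>\<^sub>\<le>\<^sub>0" "1 - z \<notin> \<int>\<^sub>\<le>\<^sub>0"
    by (rule not_Ints_imp_not_nonpos_Ints[OF assms])+
  have nz: "sin (of_real pi * z) \<noteq> 0"
    using z rGamma_reflection_complex[of z] rGamma_eq_zero_iff by (metis div_0 mult_eq_0_iff)
  have op: "open (- \<int> :: complex set)" by (simp add: closed_Ints open_Compl)
  have "((\<lambda>z. Digamma (1 - z) - Digamma z) has_field_derivative
      (Polygamma 1 (1 - z) * (-1) - Polygamma 1 z)) (at z)"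
    using z by (auto intro!: derivative_eq_intros)
  hence "((\<lambda>z. of_real pi * cot (of_real pi * z)) has_field_derivative
      (Polygamma 1 (1 - z) * (-1) - Polygamma 1 z)) (at z)"
    by (rule DERIV_cong_ev[THEN iffD1, OF refl _ refl, rotated])
      (rule eventually_mono[OF eventually_nhds_in_open[OF op]], use assms in \<open>auto simp: Digamma_reflection_complex\<close>)
  moreover have "((\<lambda>z. of_real pi * cot (of_real pi * z)) has_field_derivative
      - (of_real pi ^ 2 / sin (of_real pi * z) ^ 2)) (at z)"
    using nz by (auto intro!: derivative_eq_intros DERIV_cot[THEN DERIV_chain2] simp: field_simps power2_eq_square)
  ultimately have "Polygamma 1 (1 - z) * (-1) - Polygamma 1 z = - (of_real pi ^ 2 / sin (of_real pi * z) ^ 2)"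
    by (rule DERIV_unique)
  thus ?thesis by (simp add: algebra_simps)
qed

lemma csc_squared_partial_fractions:
  fixes z :: complex
  assumes z: "z \<notin> \<int>"
  shows "(\<lambda>n. 1 / (z + of_nat (Suc n))\<^sup>2 + 1 / (z - of_nat (Suc n))\<^sup>2) sums
           (of_real pi ^ 2 / sin (of_real pi * z) ^ 2 - 1 / z\<^sup>2)"
proof -
  have nz: "z \<noteq> 0" "z + 1 \<noteq> 0" "1 - z \<noteq> 0"
    using z by (auto, metis Ints_0 Ints_1 Ints_diff add_diff_cancel_right')
  have "(\<lambda>k. inverse ((z + 1 + of_nat k)^2) + inverse ((1 - z + of_nat k)^2)) sums
     (Polygamma 1 (z + 1) + Polygamma 1 (1 - z))"
    using sums_add[OF Polygamma_LIMSEQ[OF nz(2), of 1] Polygamma_LIMSEQ[OF nz(3), of 1]]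
    by (simp add: numeral_2_eq_2)
  moreover have "Polygamma 1 (z + 1) + Polygamma 1 (1 - z) = of_real pi ^ 2 / sin (of_real pi * z) ^ 2 - 1 / z\<^sup>2"
    using Polygamma_plus1[OF nz(1), of 1] Polygamma_1_reflection_complex[OF z] by (simp add: numeral_2_eq_2)
  moreover have "(1 - z + of_nat k)^2 = (z - of_nat (Suc k))^2" for k
    by (simp add: power2_commute algebra_simps)
  ultimately show ?thesis by (simp only: inverse_eq_divide of_nat_Suc add.assoc)
qed

section \<open>The transformation law of \<open>E\<^sub>2\<close>\<close>

definition csc2 :: "complex \<Rightarrow> complex" where
  "csc2 w = of_real pi ^ 2 / sin (of_real pi * w) ^ 2"

lemma csc2_minus: "csc2 (- w) = csc2 w"
  by (simp add: csc2_def)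

lemma Im_nonzero_not_Int: "Im w \<noteq> 0 \<Longrightarrow> w \<notin> \<int>"
  by (auto simp: complex_is_Int_iff)

text \<open>
  The series of \<open>1 / (m z + n)\<^sup>2\<close> does not converge absolutely; subtracting a difference that
  telescopes in \<open>n\<close> turns its terms into \<open>- 1 / (x\<^sup>2 (x\<^sup>2 - 1))\<close> with \<open>x = m z + n\<close>, so that the order of
  summation may be exchanged.
\<close>

definition eis_term :: "complex \<Rightarrow> complex" where
  "eis_term x = 1 / x\<^sup>2 - (1 / (x - 1) - 1 / (x + 1)) / 2"

lemma eis_term_altdef:
  assumes "Im x \<noteq> 0"
  shows "eis_term x = - (1 / (x * x * ((x - 1) * (x + 1))))"
proof -
  have "x \<noteq> 0" "x - 1 \<noteq> 0" "x + 1 \<noteq> 0"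
    using assms by (auto simp: complex_eq_iff)
  hence "(1 / (x - 1) - 1 / (x + 1)) / 2 = 1 / ((x - 1) * (x + 1))"
    and "1 / x\<^sup>2 - 1 / ((x - 1) * (x + 1)) = ((x - 1) * (x + 1) - x * x) / (x * x * ((x - 1) * (x + 1)))"
    by (simp_all only: diff_frac_eq power2_eq_square mult_eq_0_iff simp_thms) simp_all
  moreover have "(x - 1) * (x + 1) - x * x = -1" by (simp add: algebra_simps)
  ultimately show ?thesis by (simp add: eis_term_def)
qed

section \<open>Absolute convergence of the corrected lattice sum\<close>

lemma norm_lattice_ge:
  assumes "Im z > 0"
  obtains K where "K > 0" "\<And>m n :: real. m\<^sup>2 + n\<^sup>2 \<le> K * (norm (of_real m * z + of_real n))\<^sup>2"
proof
  define x y where "x = Re z" and "y = Im z"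
  \<comment> \<open>From n = (m x + n) - m x and m = (m y) / y, where m x + n and m y are the real
    and imaginary parts of the lattice point.\<close>
  let ?K = "2 + (1 + 2 * x\<^sup>2) / y\<^sup>2"
  have y: "y > 0" using assms by (simp add: y_def)
  show "?K > 0" by (intro add_pos_nonneg) auto
  fix m n :: real
  have "n\<^sup>2 + (n + 2 * (m * x))\<^sup>2 = 2 * (m * x + n)\<^sup>2 + 2 * (m * x)\<^sup>2"
    by (simp add: power2_eq_square algebra_simps)
  hence "n\<^sup>2 \<le> 2 * (m * x + n)\<^sup>2 + 2 * (m * x)\<^sup>2"
    by (smt (verit) zero_le_power2)
  hence "m\<^sup>2 + n\<^sup>2 \<le> 2 * (m * x + n)\<^sup>2 + (1 + 2 * x\<^sup>2) * m\<^sup>2"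
    by (simp add: algebra_simps power_mult_distrib)
  also have "\<dots> = 2 * (m * x + n)\<^sup>2 + (1 + 2 * x\<^sup>2) / y\<^sup>2 * (m * y)\<^sup>2"
    using y by (simp add: power_mult_distrib)
  also have "\<dots> \<le> ?K * (m * x + n)\<^sup>2 + ?K * (m * y)\<^sup>2"
    by (intro add_mono mult_right_mono) auto
  also have "\<dots> = ?K * (norm (of_real m * z + of_real n))\<^sup>2"
    by (simp add: cmod_power2 x_def y_def distrib_left)
  finally show "m\<^sup>2 + n\<^sup>2 \<le> ?K * (norm (of_real m * z + of_real n))\<^sup>2" .
qed

text \<open>The factors of the denominator in \<open>eis_term_altdef\<close> are lattice points at n
  and n +- 1, each of norm at least a multiple of sqrt(m^2 + n^2). The bound is split into a factor
  in m and a factor in n so that a product of two convergent series dominates the double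
  series.\<close>

lemma norm_eis_term_le:
  assumes "Im z > 0"
  obtains C where "C > 0"
    "\<And>m n :: real. m \<ge> 1 \<Longrightarrow> norm (eis_term (of_real m * z + of_real n)) \<le> C * (1 / m\<^sup>2 * (1 / (1 + n\<^sup>2)))"
proof -
  from norm_lattice_ge[OF assms] obtain K where K: "K > 0"
    "\<And>m n :: real. m\<^sup>2 + n\<^sup>2 \<le> K * (norm (of_real m * z + of_real n))\<^sup>2" by blast
  have "norm (eis_term (of_real m * z + of_real n)) \<le> (3 * K\<^sup>2) * (1 / m\<^sup>2 * (1 / (1 + n\<^sup>2)))"
    if m: "m \<ge> 1" for m n :: real
  proof -
    define x where "x = of_real m * z + of_real n"
    define u where "u = norm x" define v where "v = norm (x - 1)" define w where "w = norm (x + 1)"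
    have "Im x > 0" using assms m by (simp add: x_def)
    hence eq: "norm (eis_term x) = 1 / (u * u * (v * w))"
      by (subst eis_term_altdef) (auto simp: u_def v_def w_def norm_divide norm_mult)
    have pos: "u > 0" "v > 0" "w > 0"
      using \<open>Im x > 0\<close> by (auto simp: u_def v_def w_def complex_eq_iff)
    have m2: "1 \<le> m\<^sup>2" using m by simp
    have u: "m\<^sup>2 + n\<^sup>2 \<le> K * u\<^sup>2" using K(2)[of m n] by (simp add: u_def x_def)
    have v: "m\<^sup>2 + (n - 1)\<^sup>2 \<le> K * v\<^sup>2" using K(2)[of m "n - 1"] by (simp add: v_def x_def algebra_simps)
    have w: "m\<^sup>2 + (n + 1)\<^sup>2 \<le> K * w\<^sup>2" using K(2)[of m "n + 1"] by (simp add: w_def x_def algebra_simps)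
    have "n\<^sup>2 + (n - 2)\<^sup>2 = 2 * (n - 1)\<^sup>2 + 2" "n\<^sup>2 + (n + 2)\<^sup>2 = 2 * (n + 1)\<^sup>2 + 2"
      by (simp_all add: power2_eq_square algebra_simps)
    hence n1: "n\<^sup>2 \<le> 2 * (n - 1)\<^sup>2 + 2" "n\<^sup>2 \<le> 2 * (n + 1)\<^sup>2 + 2"
      by (smt (verit) zero_le_power2)+
    \<comment> \<open>The shift of n by one costs a factor 3; the constant 2 in \<open>n1\<close> is
      absorbed by m \<ge> 1.\<close>
    have v': "m\<^sup>2 + n\<^sup>2 \<le> 3 * K * v\<^sup>2" and w': "m\<^sup>2 + n\<^sup>2 \<le> 3 * K * w\<^sup>2"
      using n1 m2 v w zero_le_power2[of "n - 1"] zero_le_power2[of "n + 1"] by linarith+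
    have "(m\<^sup>2 + n\<^sup>2)\<^sup>2 \<le> (3 * K * v\<^sup>2) * (3 * K * w\<^sup>2)"
      unfolding power2_eq_square[of "m\<^sup>2 + n\<^sup>2"] using v' w' m2 K(1) by (intro mult_mono) auto
    also have "\<dots> = (3 * K * (v * w))\<^sup>2" by (simp add: power_mult_distrib power2_eq_square)
    finally have vw: "m\<^sup>2 + n\<^sup>2 \<le> 3 * K * (v * w)"
      by (rule power2_le_imp_le) (use pos K(1) in auto)
    have "m\<^sup>2 * (1 + n\<^sup>2) \<le> (m\<^sup>2 + n\<^sup>2) * (m\<^sup>2 + n\<^sup>2)"
      using m2 by (intro mult_mono) auto
    also have "\<dots> \<le> (K * u\<^sup>2) * (3 * K * (v * w))"
      using u vw m2 K(1) by (intro mult_mono) auto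
    also have "\<dots> = 3 * K\<^sup>2 * (u * u * (v * w))" by (simp add: power2_eq_square)
    finally have le: "m\<^sup>2 * (1 + n\<^sup>2) \<le> 3 * K\<^sup>2 * (u * u * (v * w))" .
    have mp: "m\<^sup>2 * (1 + n\<^sup>2) > 0" using m2 by (intro mult_pos_pos add_pos_nonneg) auto
    have "1 / (u * u * (v * w)) \<le> 3 * K\<^sup>2 / (m\<^sup>2 * (1 + n\<^sup>2))"
      using le mp pos by (simp add: divide_simps split: if_splits)
    thus ?thesis using eq by (simp add: x_def)
  qed
  with K(1) show ?thesis by (intro that[of "3 * K\<^sup>2"]) auto
qed

text \<open>Only positive multiples \<open>Suc m\<close> of z occur, because the summand is even in
  x. Pairing n with -n matches the symmetric partial fraction series.\<close>

definition eis_pair :: "complex \<Rightarrow> nat \<Rightarrow> nat \<Rightarrow> complex" where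
  "eis_pair z m n = (if n = 0 then eis_term (of_nat (Suc m) * z)
     else eis_term (of_nat (Suc m) * z + of_nat n) + eis_term (of_nat (Suc m) * z - of_nat n))"

lemma summable_inverse_Suc_squares: "summable (\<lambda>n. 1 / (real (Suc n))\<^sup>2)"
  using inverse_squares_sums by (simp add: sums_iff add_ac)

lemma summable_inverse_one_plus_squares: "summable (\<lambda>n. 1 / (1 + (real n)\<^sup>2))"
proof (rule summable_comparison_test')
  show "summable (\<lambda>n. 2 * (1 / (real (Suc n))\<^sup>2))"
    by (intro summable_mult summable_inverse_Suc_squares)
  fix n :: nat assume "n \<ge> 0"
  have "2 * (1 + (real n)\<^sup>2) - (real (Suc n))\<^sup>2 = (real n - 1)\<^sup>2"
    by (simp add: power2_eq_square algebra_simps)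
  hence "(real (Suc n))\<^sup>2 \<le> 2 * (1 + (real n)\<^sup>2)" by (smt (verit) zero_le_power2)
  moreover have "0 < 1 + (real n)\<^sup>2" by (intro add_pos_nonneg) auto
  ultimately show "norm (1 / (1 + (real n)\<^sup>2)) \<le> 2 * (1 / (real (Suc n))\<^sup>2)"
    by (simp add: divide_simps)
qed

lemma summable_on_prod_nonneg:
  fixes f :: "'a \<Rightarrow> real" and g :: "'b \<Rightarrow> real"
  assumes f: "f summable_on A" and g: "g summable_on B"
    and "\<And>x. x \<in> A \<Longrightarrow> f x \<ge> 0" "\<And>y. y \<in> B \<Longrightarrow> g y \<ge> 0"
  shows "(\<lambda>(x, y). f x * g y) summable_on (A \<times> B)"
proof (rule summable_on_SigmaI)
  show "((\<lambda>y. case (x, y) of (x, y) \<Rightarrow> f x * g y) has_sum f x * infsum g B) B" for x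
    using has_sum_cmult_right[OF has_sum_infsum[OF g]] by simp
  show "(\<lambda>x. f x * infsum g B) summable_on A"
    by (rule summable_on_cmult_left[OF f])
qed (use assms in auto)

lemma eis_pair_summable:
  assumes "Im z > 0"
  shows "(\<lambda>(m, n). eis_pair z m n) summable_on (UNIV \<times> UNIV)"
proof -
  from norm_eis_term_le[OF assms] obtain C where C: "C > 0"
    "\<And>m n :: real. m \<ge> 1 \<Longrightarrow> norm (eis_term (of_real m * z + of_real n)) \<le> C * (1 / m\<^sup>2 * (1 / (1 + n\<^sup>2)))"
    by blast
  have bound: "norm (eis_pair z m n) \<le> (2 * C) * (1 / (real (Suc m))\<^sup>2 * (1 / (1 + (real n)\<^sup>2)))" for m n
  proof (cases "n = 0")
    case True
    have "norm (eis_pair z m n) \<le> C * (1 / (real (Suc m))\<^sup>2 * (1 / (1 + (real n)\<^sup>2)))"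
      using C(2)[of "real (Suc m)" 0] True by (simp add: eis_pair_def)
    also have "\<dots> \<le> (2 * C) * (1 / (real (Suc m))\<^sup>2 * (1 / (1 + (real n)\<^sup>2)))"
      using C(1) by (intro mult_right_mono) auto
    finally show ?thesis .
  next
    case False
    have "norm (eis_pair z m n) \<le> norm (eis_term (of_real (real (Suc m)) * z + of_real (real n)))
       + norm (eis_term (of_real (real (Suc m)) * z + of_real (- real n)))"
      using False by (simp add: eis_pair_def norm_triangle_ineq)
    also have "\<dots> \<le> C * (1 / (real (Suc m))\<^sup>2 * (1 / (1 + (real n)\<^sup>2))) + C * (1 / (real (Suc m))\<^sup>2 * (1 / (1 + (- real n)\<^sup>2)))"
      by (intro add_mono C(2)) auto
    finally show ?thesis by (simp add: mult_ac)
  qed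
  have "(\<lambda>(m, n). 1 / (real (Suc m))\<^sup>2 * (1 / (1 + (real n)\<^sup>2))) summable_on (UNIV \<times> UNIV)"
    by (intro summable_on_prod_nonneg norm_summable_imp_summable_on)
       (use summable_inverse_Suc_squares summable_inverse_one_plus_squares in simp_all)
  hence "(\<lambda>x. (2 * C) * (case x of (m, n) \<Rightarrow> 1 / (real (Suc m))\<^sup>2 * (1 / (1 + (real n)\<^sup>2)))) summable_on (UNIV \<times> UNIV)"
    by (rule summable_on_cmult_right)
  hence "(\<lambda>x. norm (case x of (m, n) \<Rightarrow> eis_pair z m n)) summable_on (UNIV \<times> UNIV)"
    by (rule Infinite_Sum.abs_summable_on_comparison_test') (use bound in auto)
  thus ?thesis by (rule Infinite_Sum.abs_summable_summable)
qed

section \<open>Row and column sums of the lattice sum\<close>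

lemma csc2_sums:
  assumes "w \<notin> \<int>"
  shows "(\<lambda>n. if n = 0 then 1 / w\<^sup>2 else 1 / (w + of_nat n)\<^sup>2 + 1 / (w - of_nat n)\<^sup>2) sums csc2 w"
  using sums_Suc_iff[of "\<lambda>n. if n = 0 then 1 / w\<^sup>2 else 1 / (w + of_nat n)\<^sup>2 + 1 / (w - of_nat n)\<^sup>2"]
    csc_squared_partial_fractions[OF assms] by (simp add: csc2_def)

text \<open>For n > 0 the two corrections add up to half the difference of T at n + 1 and n - 1,
  rewritten as a first difference of \<open>T n + T (n - 1)\<close> so that it telescopes. At n = 0
  the truncated \<open>n - 1\<close> is again 0, which is harmless because
  \<open>T 0 = 0\<close>.\<close>

lemma eis_pair_telescope:
  fixes z :: complex and m n :: nat
  defines "w \<equiv> of_nat (Suc m) * z"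
  defines "T \<equiv> \<lambda>n :: nat. 1 / (w - of_nat n) - 1 / (w + of_nat n)"
  shows "eis_pair z m n =
    (if n = 0 then 1 / w\<^sup>2 else 1 / (w + of_nat n)\<^sup>2 + 1 / (w - of_nat n)\<^sup>2)
      - ((T (Suc n) + T n) - (T n + T (n - 1))) / 2"
proof (cases n)
  case 0
  thus ?thesis by (simp add: eis_pair_def eis_term_def T_def w_def)
next
  case (Suc k)
  have e: "w + of_nat (Suc k) - 1 = w + of_nat k" "w + of_nat (Suc k) + 1 = w + of_nat (Suc (Suc k))"
     "w - of_nat (Suc k) - 1 = w - of_nat (Suc (Suc k))" "w - of_nat (Suc k) + 1 = w - of_nat k"
    by simp_all
  show ?thesis unfolding Suc eis_pair_def w_def[symmetric] eis_term_def e T_def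
    by (simp add: field_simps del: of_nat_Suc)
qed

lemma tendsto_inverse_add_of_nat: "(\<lambda>n. 1 / (w + of_nat n)) \<longlonglongrightarrow> (0 :: complex)"
  unfolding inverse_eq_divide[symmetric]
  by (intro filterlim_compose[OF tendsto_inverse_0]
        tendsto_add_filterlim_at_infinity[OF tendsto_const] tendsto_of_nat)

lemma tendsto_inverse_diff_of_nat: "(\<lambda>n. 1 / (w - of_nat n)) \<longlonglongrightarrow> (0 :: complex)"
proof -
  have "1 / (w - of_nat n) = - (1 / (- w + of_nat n))" for n
    by (metis add.commute minus_diff_eq minus_divide_right uminus_add_conv_diff)
  thus ?thesis using tendsto_minus[OF tendsto_inverse_add_of_nat[of "-w"]] by simp
qed

lemma eis_pair_row_sums:
  assumes "Im z > 0"
  shows "eis_pair z m sums csc2 (of_nat (Suc m) * z)"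
proof -
  define w where "w = of_nat (Suc m) * z"
  define T where "T = (\<lambda>n :: nat. 1 / (w - of_nat n) - 1 / (w + of_nat n))"
  have w: "w \<notin> \<int>" using assms by (intro Im_nonzero_not_Int) (simp add: w_def del: of_nat_Suc)
  have T: "T \<longlonglongrightarrow> 0"
    unfolding T_def using tendsto_diff[OF tendsto_inverse_diff_of_nat tendsto_inverse_add_of_nat] by simp
  hence "(\<lambda>n. T (n - 1)) \<longlonglongrightarrow> 0"
    using LIMSEQ_imp_Suc[of "\<lambda>n. T (n - 1)" 0] by simp
  hence U: "(\<lambda>n. T n + T (n - 1)) \<longlonglongrightarrow> 0" using tendsto_add[OF T] by simp
  have "(\<lambda>n. ((T (Suc n) + T n) - (T n + T (n - 1))) / 2) sums ((0 - (T 0 + T (0 - 1))) / 2)"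
    using telescope_sums[OF U] by (intro sums_divide) simp
  from sums_diff[OF csc2_sums[OF w] this] show ?thesis
    unfolding eis_pair_telescope[of z m, abs_def] w_def[symmetric] T_def by simp
qed

lemma inverse_squares_sums_complex: "(\<lambda>n. 1 / (of_nat (Suc n))\<^sup>2) sums (of_real pi ^ 2 / 6 :: complex)"
proof -
  have "(\<lambda>n. of_real (1 / (real n + 1)\<^sup>2)) sums (of_real (pi\<^sup>2 / 6) :: complex)"
    using inverse_squares_sums by (subst sums_of_real_iff) (simp add: add_ac)
  thus ?thesis by (simp add: add_ac)
qed

lemma cot_exp:
  assumes "exp (- 2 * \<i> * w) \<noteq> 1"
  shows "cot w = \<i> * (1 + exp (- 2 * \<i> * w)) / (1 - exp (- 2 * \<i> * w))"
proof -
  define a where "a = exp (\<i> * w)"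
  have a: "a \<noteq> 0" by (simp add: a_def)
  have e: "exp (- (\<i> * w)) = 1 / a" by (simp add: a_def exp_minus field_simps)
  have e2: "exp (- 2 * \<i> * w) = 1 / a ^ 2"
    unfolding a_def by (simp add: exp_minus field_simps flip: exp_double exp_add)
  define c s where "c = a + 1 / a" and "s = a - 1 / a"
  have cs: "cos w = c / 2" "sin w = s / (2 * \<i>)"
    unfolding cos_exp_eq sin_exp_eq e a_def[symmetric] c_def s_def by simp_all
  have "cot w = \<i> * c / s"
    unfolding cot_def cs by (cases "s = 0") (simp_all add: field_simps)
  also have "\<dots> = \<i> * (1 + 1 / a ^ 2) / (1 - 1 / a ^ 2)"
  proof -
    have "c / a = 1 + 1 / a ^ 2" "s / a = 1 - 1 / a ^ 2"
      using a by (simp_all add: c_def s_def add_divide_distrib diff_divide_distrib power2_eq_square)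
    moreover have "\<i> * c / s = \<i> * (c / a) / (s / a)" using a by simp
    ultimately show ?thesis by (simp only:)
  qed
  finally show ?thesis unfolding e2 .
qed

text \<open>Since n/z moves down the lower half-plane, exp(- 2 pi i n/z) decays and cot tends to i.
  That this limit is not 0 is the source of the non-modular term of E_2.\<close>

lemma cot_lower_half_plane_tendsto:
  assumes "Im z > 0"
  shows "(\<lambda>n. cot (of_real pi * (of_nat n / z))) \<longlonglongrightarrow> \<i>"
proof -
  define r where "r = exp (- 2 * \<i> * of_real pi / z)"
  have "Re (- 2 * \<i> * of_real pi / z) = - 2 * pi * Im z / (cmod z)\<^sup>2"
    by (simp add: Re_divide cmod_power2 field_simps)
  also have "\<dots> < 0" using assms by (intro divide_neg_pos) (auto simp: mult_neg_pos)
  finally have r: "norm r < 1" by (simp add: r_def)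
  have rn: "exp (- 2 * \<i> * (of_real pi * (of_nat n / z))) = r ^ n" for n
    by (simp add: r_def flip: exp_of_nat_mult) (simp add: field_simps)
  have ne: "r ^ n \<noteq> 1" if "n > 0" for n
    using r that by (metis norm_one norm_power power_less_one_iff norm_ge_zero less_irrefl)
  have "(\<lambda>n. \<i> * (1 + r ^ n) / (1 - r ^ n)) \<longlonglongrightarrow> \<i> * (1 + 0) / (1 - 0)"
    by (intro tendsto_intros LIMSEQ_power_zero r) auto
  moreover have "\<forall>\<^sub>F n in sequentially. \<i> * (1 + r ^ n) / (1 - r ^ n) = cot (of_real pi * (of_nat n / z))"
    using eventually_gt_at_top[of 0]
  proof eventually_elim
    case (elim n)
    show ?case using cot_exp[of "of_real pi * (of_nat n / z)"] ne[OF elim] unfolding rn by simp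
  qed
  ultimately show ?thesis using Lim_transform_eventually by fastforce
qed

text \<open>The double series \<open>eis_pair z\<close> is summed in both orders. Rows give csc2 at
  the multiples of z, and their corrections telescope to 0; columns give csc2 at the multiples of
  1/z, but their corrections telescope to - i pi / z. The two terms pi^2/6 come from the axes n = 0
  and m = 0 of the lattice.\<close>

lemma csc2_inversion:
  assumes z: "Im z > 0" and S: "(\<lambda>m. csc2 (of_nat (Suc m) * z)) sums S"
  shows "(\<lambda>n. csc2 (of_nat (Suc n) * (- 1 / z))) sums
           (z\<^sup>2 * (S + of_real pi ^ 2 / 6 - \<i> * of_real pi / z) - of_real pi ^ 2 / 6)"
proof -
  have z0: "z \<noteq> 0" using z by auto
  define s where "s = (\<lambda>m n. if n = 0 then 1 / (of_nat (Suc m) * z)\<^sup>2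
     else 1 / (of_nat (Suc m) * z + of_nat n)\<^sup>2 + 1 / (of_nat (Suc m) * z - of_nat n)\<^sup>2)"
  define T where "T = (\<lambda>m n :: nat. 1 / (of_nat (Suc m) * z - of_nat n) - 1 / (of_nat (Suc m) * z + of_nat n))"
  \<comment> \<open>K and H are the column sums of s and T, obtained from the partial fractions at
    n/z after division by z^2 and by z.\<close>
  define K where "K = (\<lambda>n. if n = 0 then of_real pi ^ 2 / 6 / z\<^sup>2
     else (csc2 (of_nat n / z) - 1 / (of_nat n / z)\<^sup>2) / z\<^sup>2)"
  define H where "H = (\<lambda>n :: nat. if n = 0 then 0
     else - (of_real pi * cot (of_real pi * (of_nat n / z)) - 1 / (of_nat n / z)) / z)"
  have notint: "of_nat n / z \<notin> \<int>" if "n > 0" for n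
    using that z by (intro Im_nonzero_not_Int) (auto simp: Im_divide sum_power2_eq_zero_iff)
  have col_s: "(\<lambda>m. s m n) sums K n" for n
  proof (cases "n = 0")
    case True
    have "(\<lambda>m. 1 / (of_nat (Suc m))\<^sup>2 / z\<^sup>2) sums (of_real pi ^ 2 / 6 / z\<^sup>2)"
      by (intro sums_divide inverse_squares_sums_complex)
    thus ?thesis using True by (simp add: s_def K_def power_mult_distrib del: of_nat_Suc)
  next
    case False
    have "1 / (of_nat n / z + of_nat (Suc m))\<^sup>2 / z\<^sup>2 = 1 / (of_nat (Suc m) * z + of_nat n)\<^sup>2"
         "1 / (of_nat n / z - of_nat (Suc m))\<^sup>2 / z\<^sup>2 = 1 / (of_nat (Suc m) * z - of_nat n)\<^sup>2" for m
    proof -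
      have "(of_nat n / z + of_nat (Suc m)) * z = of_nat (Suc m) * z + of_nat n"
           "(of_nat n / z - of_nat (Suc m)) * z = - (of_nat (Suc m) * z - of_nat n)"
        using z0 by (simp_all add: field_simps del: of_nat_Suc)
      hence "(of_nat n / z + of_nat (Suc m))\<^sup>2 * z\<^sup>2 = (of_nat (Suc m) * z + of_nat n)\<^sup>2"
            "(of_nat n / z - of_nat (Suc m))\<^sup>2 * z\<^sup>2 = (of_nat (Suc m) * z - of_nat n)\<^sup>2"
        by (metis power_mult_distrib, metis power_mult_distrib power2_minus)
      thus "1 / (of_nat n / z + of_nat (Suc m))\<^sup>2 / z\<^sup>2 = 1 / (of_nat (Suc m) * z + of_nat n)\<^sup>2"
         "1 / (of_nat n / z - of_nat (Suc m))\<^sup>2 / z\<^sup>2 = 1 / (of_nat (Suc m) * z - of_nat n)\<^sup>2"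
        by (metis divide_divide_eq_left)+
    qed
    with sums_divide[OF csc_squared_partial_fractions[OF notint[of n]], of "z\<^sup>2"] False show ?thesis
      by (simp add: s_def K_def csc2_def add_divide_distrib del: of_nat_Suc)
  qed
  have col_T: "(\<lambda>m. T m n) sums H n" for n
  proof (cases "n = 0")
    case True
    thus ?thesis by (simp add: T_def H_def)
  next
    case False
    have "- (1 / (of_nat n / z + of_nat (Suc m)) + 1 / (of_nat n / z - of_nat (Suc m))) / z = T m n" for m
    proof -
      have "(of_nat n / z + of_nat (Suc m)) * z = of_nat (Suc m) * z + of_nat n"
           "(of_nat n / z - of_nat (Suc m)) * z = - (of_nat (Suc m) * z - of_nat n)"
        using z0 by (simp_all add: field_simps del: of_nat_Suc)
      hence "1 / (of_nat n / z + of_nat (Suc m)) / z = 1 / (of_nat (Suc m) * z + of_nat n)"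
            "1 / (of_nat n / z - of_nat (Suc m)) / z = - (1 / (of_nat (Suc m) * z - of_nat n))"
        by (metis divide_divide_eq_left, metis divide_divide_eq_left minus_divide_right)
      thus ?thesis unfolding T_def minus_add_distrib add_divide_distrib by (simp del: of_nat_Suc)
    qed
    with sums_divide[OF sums_minus[OF cot_partial_fractions[OF notint[of n]]], of z] False show ?thesis
      by (simp add: H_def del: of_nat_Suc)
  qed
  have H: "H \<longlonglongrightarrow> - (of_real pi * \<i> - 0) / z"
  proof (rule Lim_transform_eventually)
    show "(\<lambda>n. - (of_real pi * cot (of_real pi * (of_nat n / z)) - z * (1 / (0 + of_nat n))) / z) \<longlonglongrightarrow>
       - (of_real pi * \<i> - 0) / z"
      by (rule tendsto_eq_intros cot_lower_half_plane_tendsto[OF z] tendsto_inverse_add_of_nat refl z0)+ simp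
    show "\<forall>\<^sub>F n in sequentially. - (of_real pi * cot (of_real pi * (of_nat n / z)) - z * (1 / (0 + of_nat n))) / z = H n"
      using eventually_gt_at_top[of 0] by eventually_elim (simp add: H_def)
  qed
  hence "(\<lambda>n. H (n - 1)) \<longlonglongrightarrow> - (of_real pi * \<i> - 0) / z"
    using LIMSEQ_imp_Suc[of "\<lambda>n. H (n - 1)"] by simp
  from tendsto_add[OF H this] have V: "(\<lambda>n. H n + H (n - 1)) \<longlonglongrightarrow> - 2 * \<i> * of_real pi / z"
    by (simp add: field_simps)
  have col: "(\<lambda>m. eis_pair z m n) sums (K n - ((H (Suc n) + H n) - (H n + H (n - 1))) / 2)" for n
    unfolding eis_pair_telescope s_def[symmetric]
    using sums_diff[OF col_s[of n] sums_divide[OF sums_diff[OF sums_add[OF col_T[of "Suc n"] col_T[of n]]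
         sums_add[OF col_T[of n] col_T[of "n - 1"]]], of 2]]
    unfolding s_def T_def by (simp del: of_nat_Suc)
  define A where "A = infsum (\<lambda>(m, n). eis_pair z m n) (UNIV \<times> UNIV)"
  have A: "((\<lambda>(m, n). eis_pair z m n) has_sum A) (UNIV \<times> UNIV)"
    unfolding A_def by (rule has_sum_infsum[OF eis_pair_summable[OF z]])
  hence A': "((\<lambda>(n, m). eis_pair z m n) has_sum A) (UNIV \<times> UNIV)"
    by (subst (asm) has_sum_swap) (simp add: case_prod_unfold)
  have hs: "(f has_sum s) UNIV" if "f summable_on UNIV" "f sums s" for f :: "nat \<Rightarrow> complex" and s
    using that has_sum_imp_sums sums_unique2 has_sum_infsum by metis
  have "((\<lambda>m. csc2 (of_nat (Suc m) * z)) has_sum A) UNIV"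
  proof (rule has_sum_SigmaD[OF A])
    fix m
    have "(\<lambda>n. eis_pair z m n) summable_on UNIV"
      using summable_on_SigmaD1[OF eis_pair_summable[OF z], of m] by simp
    thus "((\<lambda>n. case (m, n) of (m, n) \<Rightarrow> eis_pair z m n) has_sum csc2 (of_nat (Suc m) * z)) UNIV"
      using hs[OF _ eis_pair_row_sums[OF z]] by simp
  qed
  from has_sum_imp_sums[OF this] S have AS: "A = S" by (metis sums_unique2)
  have "((\<lambda>n. K n - ((H (Suc n) + H n) - (H n + H (n - 1))) / 2) has_sum A) UNIV"
  proof (rule has_sum_SigmaD[OF A'])
    fix n
    have "(\<lambda>m. eis_pair z m n) summable_on UNIV"
      using summable_on_SigmaD1[OF has_sum_imp_summable[OF A'], of n] by simp
    thus "((\<lambda>m. case (n, m) of (n, m) \<Rightarrow> eis_pair z m n) has_sum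
        (K n - ((H (Suc n) + H n) - (H n + H (n - 1))) / 2)) UNIV"
      using hs[OF _ col] by simp
  qed
  from has_sum_imp_sums[OF this]
  have "(\<lambda>n. K n - ((H (Suc n) + H n) - (H n + H (n - 1))) / 2) sums S" unfolding AS .
  moreover have "(\<lambda>n. ((H (Suc n) + H n) - (H n + H (n - 1))) / 2) sums ((- 2 * \<i> * of_real pi / z - (H 0 + H (0 - 1))) / 2)"
    using telescope_sums[OF V] by (intro sums_divide) simp
  ultimately have "K sums (S + (- 2 * \<i> * of_real pi / z - (H 0 + H (0 - 1))) / 2)"
    using sums_add by fastforce
  hence "K sums (S - \<i> * of_real pi / z)" by (simp add: H_def field_simps)
  hence "(\<lambda>n. K (Suc n)) sums (S - \<i> * of_real pi / z - K 0)" by (simp add: sums_Suc_iff)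
  \<comment> \<open>The summands 1/(n + 1)^2 restore the row m = 0, which completes each column to a
    full csc2.\<close>
  from sums_add[OF sums_mult[OF this, of "z\<^sup>2"] sums_mult[OF inverse_squares_sums_complex, of "z\<^sup>2"]]
  have "(\<lambda>n. z\<^sup>2 * K (Suc n) + z\<^sup>2 * (1 / (of_nat (Suc n))\<^sup>2)) sums
     (z\<^sup>2 * (S - \<i> * of_real pi / z - K 0) + z\<^sup>2 * (of_real pi ^ 2 / 6))" .
  moreover have "z\<^sup>2 * K (Suc n) + z\<^sup>2 * (1 / (of_nat (Suc n))\<^sup>2) = csc2 (of_nat (Suc n) * (- 1 / z))" for n
    using z0 csc2_minus[of "of_nat (Suc n) / z"] by (simp add: K_def field_simps del: of_nat_Suc)
  moreover have "z\<^sup>2 * (S - \<i> * of_real pi / z - K 0) + z\<^sup>2 * (of_real pi ^ 2 / 6)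
    = z\<^sup>2 * (S + of_real pi ^ 2 / 6 - \<i> * of_real pi / z) - of_real pi ^ 2 / 6"
    using z0 by (simp add: K_def field_simps)
  ultimately show ?thesis by simp
qed

section \<open>Expansion of E_2 in powers of q\<close>

lemma norm_q_param: "norm (q_param z) = exp (- 2 * pi * Im z)"
  by (simp add: q_param_def)

lemma norm_q_param_less_1: "Im z > 0 \<Longrightarrow> norm (q_param z) < 1"
  by (simp add: norm_q_param)

lemma q_param_nonzero [simp]: "q_param z \<noteq> 0"
  by (simp add: q_param_def)

lemma q_param_of_nat_mult: "q_param (of_nat n * z) = q_param z ^ n"
  by (simp add: q_param_def mult_ac flip: exp_of_nat_mult)

text \<open>With q = exp(2 pi i w) one has sin^2(pi w) = - (1 - q)^2 / (4 q), so csc2 is a multiple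
  of q / (1 - q)^2, a differentiated geometric series.\<close>

lemma csc2_q_sums:
  assumes "Im w > 0"
  shows "(\<lambda>n. of_nat (Suc n) * q_param w ^ Suc n) sums (- csc2 w / (4 * of_real pi ^ 2))"
proof -
  define q where "q = q_param w"
  have q: "norm q < 1" using norm_q_param_less_1[OF assms] by (simp add: q_def)
  have q1: "q \<noteq> 1" and q0: "q \<noteq> 0" using q by (auto simp: q_def)
  define a where "a = exp (\<i> * (of_real pi * w))"
  have a: "a \<noteq> 0" "q = a ^ 2"
    by (simp_all add: a_def q_def q_param_def mult_ac flip: exp_double)
  have e: "exp (- (\<i> * (of_real pi * w))) = 1 / a" by (simp add: a_def exp_minus field_simps)
  have "sin (of_real pi * w) = (a - 1 / a) / (2 * \<i>)"
    unfolding sin_exp_eq e a_def[symmetric] by simp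
  hence "sin (of_real pi * w) ^ 2 = (a - 1 / a) ^ 2 / (2 * \<i>) ^ 2" by (simp only: power_divide)
  also have "(a - 1 / a) ^ 2 = (1 - q) ^ 2 / q"
    using a by (simp add: field_simps power2_eq_square)
  finally have sin2: "sin (of_real pi * w) ^ 2 = - ((1 - q) ^ 2 / q / 4)" by (simp add: power_mult_distrib)
  have "- csc2 w / (4 * of_real pi ^ 2) = q * (1 / (1 - q) ^ 2)"
    unfolding csc2_def sin2 using q0 q1 by (simp add: field_simps)
  moreover have "(\<lambda>n. q * (of_nat (Suc n) * q ^ n)) sums (q * (1 / (1 - q) ^ 2))"
    by (intro sums_mult geometric_deriv_sums q)
  ultimately show ?thesis by (simp add: q_def mult_ac)
qed

lemma Lambert_series_sigma1:
  fixes q :: complex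
  assumes q: "norm q < 1"
  shows "(\<lambda>(m, n). of_nat (Suc n) * q ^ (Suc m * Suc n)) summable_on (UNIV \<times> UNIV)"
    and "((\<lambda>N. of_nat (divisor_power_sum 1 (Suc N)) * q ^ Suc N) has_sum
      infsum (\<lambda>(m, n). of_nat (Suc n) * q ^ (Suc m * Suc n)) (UNIV \<times> UNIV)) UNIV"
proof -
  let ?f = "\<lambda>(m, n). of_nat (Suc n) * q ^ (Suc m * Suc n)"
  have "summable (\<lambda>n. real (Suc n) * norm q ^ n)"
    using geometric_deriv_sums[of "norm q"] q by (simp add: sums_iff)
  hence "(\<lambda>(m, n). norm q ^ m * (real (Suc n) * norm q ^ n)) summable_on (UNIV \<times> UNIV)"
    using q by (intro summable_on_prod_nonneg norm_summable_imp_summable_on) (simp_all add: norm_power summable_geometric)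
  hence "(\<lambda>x. norm (?f x)) summable_on (UNIV \<times> UNIV)"
  proof (rule Infinite_Sum.abs_summable_on_comparison_test')
    fix x :: "nat \<times> nat" assume "x \<in> UNIV \<times> UNIV"
    obtain m n where x: "x = (m, n)" by force
    \<comment> \<open>Weakening the exponent to m + n makes the majorant a product of two
      one-variable series.\<close>
    have "m + n \<le> Suc m * Suc n" by simp
    hence "norm q ^ (Suc m * Suc n) \<le> norm q ^ (m + n)"
      using q by (intro power_decreasing) auto
    hence "real (Suc n) * norm q ^ (Suc m * Suc n) \<le> real (Suc n) * norm q ^ (m + n)"
      by (intro mult_left_mono) auto
    thus "norm (?f x) \<le> (case x of (m, n) \<Rightarrow> norm q ^ m * (real (Suc n) * norm q ^ n))"
      unfolding x prod.case norm_mult norm_power norm_of_nat power_add by (simp only: mult_ac)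
  qed
  thus summ: "?f summable_on (UNIV \<times> UNIV)" by (rule Infinite_Sum.abs_summable_summable)
  \<comment> \<open>The pair (m, n) stands for the factorization of N + 1 into m + 1 and the divisor
    d = n + 1; the shifts let m, n and N start at 0.\<close>
  let ?i = "\<lambda>(m, n). (Suc m * Suc n - 1, Suc n)" and ?j = "\<lambda>(N, d). (Suc N div d - 1, d - 1)"
  let ?g = "\<lambda>(N, d). of_nat d * q ^ Suc N" and ?D = "Sigma UNIV (\<lambda>N. {d. d dvd Suc N})"
  have ij: "?i (?j x) = x" "?f (?j x) = ?g x" if x: "x \<in> ?D" for x
  proof -
    obtain N d where xN: "x = (N, d)" "d dvd Suc N" using x by auto
    then obtain k where k: "Suc N = d * k" by blast
    hence pos: "d > 0" "k > 0" by (auto intro: gr0I)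
    have div: "Suc (Suc N div d - 1) = k" "Suc (d - 1) = d" using pos unfolding k by simp_all
    have kN: "k * d = Suc N" by (simp only: k mult.commute)
    show "?i (?j x) = x" "?f (?j x) = ?g x" unfolding xN(1) prod.case div kN by simp_all
  qed
  have "(?g has_sum infsum ?f (UNIV \<times> UNIV)) ?D \<longleftrightarrow> (?f has_sum infsum ?f (UNIV \<times> UNIV)) (UNIV \<times> UNIV)"
  proof (rule has_sum_reindex_bij_witness[where i = ?i and j = ?j])
    fix y :: "nat \<times> nat"
    obtain m n where y: "y = (m, n)" by force
    have S: "Suc (Suc m * Suc n - 1) = Suc m * Suc n" by simp
    show "?j (?i y) = y" "?i y \<in> ?D" unfolding y prod.case mem_Sigma_iff mem_Collect_eq S
      by (simp_all only: nonzero_mult_div_cancel_right diff_Suc_1 UNIV_I dvd_triv_right nat.distinct simp_thms)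
  qed (use ij in auto)
  with summ have "((\<lambda>(N, d). of_nat d * q ^ Suc N) has_sum infsum ?f (UNIV \<times> UNIV)) (Sigma UNIV (\<lambda>N. {d. d dvd Suc N}))"
    by (simp add: has_sum_infsum)
  thus "((\<lambda>N. of_nat (divisor_power_sum 1 (Suc N)) * q ^ Suc N) has_sum infsum ?f (UNIV \<times> UNIV)) UNIV"
  proof (rule has_sum_SigmaD)
    fix N
    have "finite {d. d dvd Suc N}" by simp
    from has_sum_finite[OF this, of "\<lambda>d. of_nat d * q ^ Suc N"]
    show "((\<lambda>d. case (N, d) of (N, d) \<Rightarrow> of_nat d * q ^ Suc N) has_sum
        (of_nat (divisor_power_sum 1 (Suc N)) * q ^ Suc N)) {d. d dvd Suc N}"
      by (simp add: divisor_power_sum_def sum_distrib_right del: power_Suc)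
  qed
qed

lemma Eisenstein_E2_csc2:
  assumes z: "Im z > 0"
  shows "(\<lambda>m. csc2 (of_nat (Suc m) * z)) sums (of_real pi ^ 2 / 6 * (Eisenstein_E2 z - 1))"
    and "(\<lambda>N. of_nat (divisor_power_sum 1 (Suc N)) * q_param z ^ Suc N) sums ((1 - Eisenstein_E2 z) / 24)"
proof -
  let ?f = "\<lambda>(m, n). of_nat (Suc n) * q_param z ^ (Suc m * Suc n)"
  define L where "L = infsum ?f (UNIV \<times> UNIV)"
  note lam = Lambert_series_sigma1[OF norm_q_param_less_1[OF z]]
  from lam(2) have L: "(\<lambda>N. of_nat (divisor_power_sum 1 (Suc N)) * q_param z ^ Suc N) sums L"
    unfolding L_def by (rule has_sum_imp_sums)
  hence LE: "L = (1 - Eisenstein_E2 z) / 24"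
    using z by (simp add: Eisenstein_E2_def upper_half_plane_def sums_iff)
  show "(\<lambda>N. of_nat (divisor_power_sum 1 (Suc N)) * q_param z ^ Suc N) sums ((1 - Eisenstein_E2 z) / 24)"
    using L unfolding LE .
  have "(?f has_sum L) (UNIV \<times> UNIV)" unfolding L_def using lam(1) by (rule has_sum_infsum)
  hence "((\<lambda>m. - csc2 (of_nat (Suc m) * z) / (4 * of_real pi ^ 2)) has_sum L) UNIV"
  proof (rule has_sum_SigmaD)
    fix m
    have *: "(\<lambda>n. of_nat (Suc n) * q_param z ^ (Suc m * Suc n)) sums (- csc2 (of_nat (Suc m) * z) / (4 * of_real pi ^ 2))"
      using csc2_q_sums[of "of_nat (Suc m) * z"] z
      unfolding q_param_of_nat_mult power_mult[symmetric] by (simp del: of_nat_Suc power_Suc)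
    have "(\<lambda>n. of_nat (Suc n) * q_param z ^ (Suc m * Suc n)) summable_on UNIV"
      using summable_on_SigmaD1[OF lam(1), of m] by simp
    thus "((\<lambda>n. case (m, n) of (m, n) \<Rightarrow> of_nat (Suc n) * q_param z ^ (Suc m * Suc n)) has_sum
        (- csc2 (of_nat (Suc m) * z) / (4 * of_real pi ^ 2))) UNIV"
      using * has_sum_imp_sums sums_unique2 has_sum_infsum unfolding prod.case by metis
  qed
  hence "(\<lambda>m. - csc2 (of_nat (Suc m) * z) / (4 * of_real pi ^ 2)) sums L" by (rule has_sum_imp_sums)
  hence "(\<lambda>m. - 4 * of_real pi ^ 2 * (- csc2 (of_nat (Suc m) * z) / (4 * of_real pi ^ 2))) sums (- 4 * of_real pi ^ 2 * L)"
    by (rule sums_mult)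
  moreover have "- 4 * of_real pi ^ 2 * L = of_real pi ^ 2 / 6 * (Eisenstein_E2 z - 1)"
    unfolding LE by (simp add: field_simps)
  moreover have "- 4 * of_real pi ^ 2 * (- c / (4 * of_real pi ^ 2)) = c" for c :: complex
    by simp
  ultimately
  show "(\<lambda>m. csc2 (of_nat (Suc m) * z)) sums (of_real pi ^ 2 / 6 * (Eisenstein_E2 z - 1))"
    by (simp only:)
qed

theorem Eisenstein_E2_inversion:
  assumes z: "Im z > 0"
  shows "Eisenstein_E2 (- 1 / z) = z\<^sup>2 * Eisenstein_E2 z + 6 * z / (\<i> * of_real pi)"
proof -
  have z0: "z \<noteq> 0" using z by auto
  have z': "Im (- 1 / z) > 0" by (rule Im_minus_inverse_pos[OF z])
  from sums_unique2[OF Eisenstein_E2_csc2(1)[OF z'] csc2_inversion[OF z Eisenstein_E2_csc2(1)[OF z]]]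
  have "of_real pi ^ 2 / 6 * (Eisenstein_E2 (- 1 / z) - 1) =
    z\<^sup>2 * (of_real pi ^ 2 / 6 * (Eisenstein_E2 z - 1) + of_real pi ^ 2 / 6 - \<i> * of_real pi / z) - of_real pi ^ 2 / 6" .
  also have "\<dots> = of_real pi ^ 2 / 6 * (z\<^sup>2 * Eisenstein_E2 z - 6 * \<i> * z / of_real pi - 1)"
    using z0 by (simp add: field_simps power2_eq_square)
  finally have "Eisenstein_E2 (- 1 / z) = z\<^sup>2 * Eisenstein_E2 z - 6 * \<i> * z / of_real pi"
    by (subst (asm) mult_cancel_left) simp
  also have "6 * \<i> * z / of_real pi = - (6 * z / (\<i> * of_real pi))"
    by (simp add: field_simps)
  finally show ?thesis by simp
qed

section \<open>Modular forms as power series\<close>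

definition q_series :: "complex fps \<Rightarrow> bool" where
  "q_series F \<longleftrightarrow> fps_conv_radius F \<ge> 1"

definition q_eval :: "complex fps \<Rightarrow> complex \<Rightarrow> complex" where
  "q_eval F z = eval_fps F (q_param z)"

definition q_deriv :: "complex fps \<Rightarrow> complex fps" where
  "q_deriv F = fps_X * fps_deriv F"

lemma q_deriv_nth [simp]: "fps_nth (q_deriv F) n = of_nat n * fps_nth F n"
  by (cases n) (simp_all add: q_deriv_def)

lemma q_deriv_add: "q_deriv (F + G) = q_deriv F + q_deriv G"
  and q_deriv_diff: "q_deriv (F - G) = q_deriv F - q_deriv G"
  and q_deriv_mult: "q_deriv (F * G) = q_deriv F * G + F * q_deriv G"
  and q_deriv_const [simp]: "q_deriv (fps_const c) = 0"
  by (simp_all add: q_deriv_def algebra_simps)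

lemma q_series_const [simp]: "q_series (fps_const c)"
  and q_series_X [simp]: "q_series fps_X"
  and q_series_0 [simp]: "q_series 0"
  by (simp_all add: q_series_def)

lemma q_series_add: "q_series F \<Longrightarrow> q_series G \<Longrightarrow> q_series (F + G)"
  unfolding q_series_def using fps_conv_radius_add[of F G] by (meson min.bounded_iff order.trans)

lemma q_series_diff: "q_series F \<Longrightarrow> q_series G \<Longrightarrow> q_series (F - G)"
  unfolding q_series_def using fps_conv_radius_diff[of F G] by (meson min.bounded_iff order.trans)

lemma q_series_mult: "q_series F \<Longrightarrow> q_series G \<Longrightarrow> q_series (F * G)"
  unfolding q_series_def using fps_conv_radius_mult[of F G] by (meson min.bounded_iff order.trans)

lemma q_series_q_deriv: "q_series F \<Longrightarrow> q_series (q_deriv F)"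
  unfolding q_deriv_def
  by (intro q_series_mult) (auto simp: q_series_def intro: order.trans fps_conv_radius_deriv)

lemma q_series_norm: "q_series F \<Longrightarrow> Im z > 0 \<Longrightarrow> ereal (norm (q_param z)) < fps_conv_radius F"
  unfolding q_series_def using norm_q_param_less_1[of z]
  by (metis ereal_less(3) less_ereal.simps(1) one_ereal_def order_less_le_trans)

lemma q_eval_const [simp]: "q_eval (fps_const c) z = c"
  and q_eval_0 [simp]: "q_eval 0 z = 0"
  and q_eval_X [simp]: "q_eval fps_X z = q_param z"
  by (simp_all add: q_eval_def)

lemma q_eval_add: "q_series F \<Longrightarrow> q_series G \<Longrightarrow> Im z > 0 \<Longrightarrow> q_eval (F + G) z = q_eval F z + q_eval G z"
  and q_eval_diff: "q_series F \<Longrightarrow> q_series G \<Longrightarrow> Im z > 0 \<Longrightarrow> q_eval (F - G) z = q_eval F z - q_eval G z"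
  and q_eval_mult: "q_series F \<Longrightarrow> q_series G \<Longrightarrow> Im z > 0 \<Longrightarrow> q_eval (F * G) z = q_eval F z * q_eval G z"
  unfolding q_eval_def by (simp_all add: eval_fps_add eval_fps_diff eval_fps_mult q_series_norm)

lemma q_param_has_field_derivative [derivative_intros]:
  "(q_param has_field_derivative (2 * of_real pi * \<i> * q_param z)) (at z within A)"
  unfolding q_param_def [abs_def] by (auto intro!: derivative_eq_intros)

lemma q_eval_has_field_derivative:
  assumes F: "q_series F" and z: "Im z > 0"
  shows "(q_eval F has_field_derivative 2 * of_real pi * \<i> * q_eval (q_deriv F) z) (at z)"
proof -
  have d: "(eval_fps F has_field_derivative eval_fps (fps_deriv F) (q_param z)) (at (q_param z))"
    by (intro has_field_derivative_eval_fps q_series_norm F z)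
  have "(q_eval F has_field_derivative eval_fps (fps_deriv F) (q_param z) * (2 * of_real pi * \<i> * q_param z)) (at z)"
    unfolding q_eval_def by (rule DERIV_chain2[OF d q_param_has_field_derivative])
  moreover have "q_series (fps_deriv F)"
    using F fps_conv_radius_deriv[of F] by (auto simp: q_series_def intro: order.trans)
  hence "q_eval (q_deriv F) z = q_param z * eval_fps (fps_deriv F) (q_param z)"
    using q_eval_mult[of fps_X "fps_deriv F" z] z by (simp add: q_deriv_def) (simp add: q_eval_def)
  ultimately show ?thesis by (simp add: mult_ac)
qed

lemma exists_q_param:
  assumes "x \<noteq> 0" "norm x < 1"
  obtains z where "Im z > 0" "q_param z = x"
proof
  have "ln (norm x) < 0" using assms by simp
  thus "Im (Ln x / (2 * of_real pi * \<i>)) > 0" using assms by (simp add: Im_divide_of_real field_simps Im_divide power2_eq_square)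
  show "q_param (Ln x / (2 * of_real pi * \<i>)) = x" using assms by (simp add: q_param_def)
qed

lemma q_eval_inj:
  assumes "q_series F" "q_series G" "\<And>z. Im z > 0 \<Longrightarrow> q_eval F z = q_eval G z"
  shows "F = G"
proof -
  have conv: "fps_conv_radius F > 0" "fps_conv_radius G > 0"
    using assms(1,2) by (auto simp: q_series_def intro: less_le_trans[of _ 1])
  have ev: "\<forall>\<^sub>F x in at 0. eval_fps F x = eval_fps G x"
    unfolding eventually_at
  proof (intro exI[of _ 1] conjI ballI impI)
    fix x :: complex assume "x \<noteq> 0 \<and> dist x 0 < 1"
    then obtain z where "Im z > 0" "q_param z = x" using exists_q_param[of x] by auto
    thus "eval_fps F x = eval_fps G x" using assms(3)[of z] by (simp add: q_eval_def)
  qed simp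
  \<comment> \<open>\<open>q_param\<close> never takes the value 0, so agreement at the centre of
    the disc comes from continuity.\<close>
  have "isCont (eval_fps F) 0" "isCont (eval_fps G) 0"
    using conv by (auto intro!: DERIV_isCont has_field_derivative_eval_fps simp: zero_ereal_def)
  hence "eval_fps F \<midarrow>0\<rightarrow> eval_fps F 0" "eval_fps G \<midarrow>0\<rightarrow> eval_fps G 0"
    by (simp_all add: isCont_def)
  moreover from this(1) ev have "eval_fps G \<midarrow>0\<rightarrow> eval_fps F 0" by (rule Lim_transform_eventually)
  ultimately have "eval_fps F 0 = eval_fps G 0" using LIM_unique by blast
  with ev have "\<forall>\<^sub>F x in nhds 0. eval_fps F x = eval_fps G x"
    by (simp add: eventually_nhds_conv_at)
  with conv show ?thesis by (rule eval_fps_eqD)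
qed

lemma has_q_expansion_iff:
  "has_q_expansion f a \<longleftrightarrow> q_series (Abs_fps a) \<and> (\<forall>z\<in>upper_half_plane. f z = q_eval (Abs_fps a) z)"
proof (intro iffI conjI ballI)
  assume h: "has_q_expansion f a"
  show "q_series (Abs_fps a)" unfolding q_series_def fps_conv_radius_def
  proof (rule conv_radius_geI_ex)
    fix r :: real assume r: "0 < r" "ereal r < 1"
    hence "complex_of_real r \<noteq> 0" "norm (complex_of_real r) < 1" by auto
    then obtain z where z: "Im z > 0" "q_param z = of_real r" by (rule exists_q_param)
    thus "\<exists>x. norm x = r \<and> summable (\<lambda>n. fps_nth (Abs_fps a) n * x ^ n)"
      using h r by (intro exI[of _ "q_param z"]) (auto simp: has_q_expansion_def upper_half_plane_def sums_iff)
  qed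
  show "f z = q_eval (Abs_fps a) z" if "z \<in> upper_half_plane" for z
    using h that by (auto simp: has_q_expansion_def q_eval_def eval_fps_def sums_iff)
next
  assume *: "q_series (Abs_fps a) \<and> (\<forall>z\<in>upper_half_plane. f z = q_eval (Abs_fps a) z)"
  show "has_q_expansion f a" unfolding has_q_expansion_def
  proof
    fix z assume z: "z \<in> upper_half_plane"
    hence "(\<lambda>n. fps_nth (Abs_fps a) n * q_param z ^ n) sums eval_fps (Abs_fps a) (q_param z)"
      using * by (intro sums_eval_fps q_series_norm) (auto simp: upper_half_plane_def)
    thus "(\<lambda>n. a n * q_param z ^ n) sums f z" using * z by (simp add: q_eval_def)
  qed
qed

section \<open>Behaviour under the inversion z -> -1/z\<close>

lemma inversion_has_field_derivative:
  assumes "Im z > 0"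
  shows "((\<lambda>z. - 1 / z) has_field_derivative (1 / z\<^sup>2)) (at z)"
  using assms by (auto intro!: derivative_eq_intros simp: power2_eq_square)

lemma eventually_nhds_Im_pos: "Im z > 0 \<Longrightarrow> \<forall>\<^sub>F w in nhds z. Im w > 0"
  using eventually_nhds_in_open[of "{z. Im z > 0}" z] by (simp add: open_halfspace_Im_gt)

text \<open>
  Expansions of modular forms of weight \<open>w\<close>: invariance under \<open>z \<mapsto> z + 1\<close> is built into the
  \<open>q\<close>-expansion, so only the inversion has to be required.
\<close>

definition modular_series :: "nat \<Rightarrow> complex fps set" where
  "modular_series w = {F. q_series F \<and> (\<forall>z. Im z > 0 \<longrightarrow> q_eval F (- 1 / z) = z ^ w * q_eval F z)}"

lemma modular_seriesI:
  assumes "q_series F" "\<And>z. Im z > 0 \<Longrightarrow> q_eval F (- 1 / z) = z ^ w * q_eval F z"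
  shows "F \<in> modular_series w"
  using assms by (simp add: modular_series_def)

lemma modular_seriesD:
  assumes "F \<in> modular_series w"
  shows "q_series F" "Im z > 0 \<Longrightarrow> q_eval F (- 1 / z) = z ^ w * q_eval F z"
  using assms by (simp_all add: modular_series_def)

lemma modular_series_add: "F \<in> modular_series w \<Longrightarrow> G \<in> modular_series w \<Longrightarrow> F + G \<in> modular_series w"
  by (intro modular_seriesI q_series_add)
     (simp_all only: q_eval_add modular_seriesD Im_minus_inverse_pos distrib_left)

lemma modular_series_diff: "F \<in> modular_series w \<Longrightarrow> G \<in> modular_series w \<Longrightarrow> F - G \<in> modular_series w"
  by (intro modular_seriesI q_series_diff)
     (simp_all only: q_eval_diff modular_seriesD Im_minus_inverse_pos right_diff_distrib)

lemma modular_series_mult: "F \<in> modular_series v \<Longrightarrow> G \<in> modular_series w \<Longrightarrow> F * G \<in> modular_series (v + w)"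
  by (intro modular_seriesI q_series_mult)
     (simp_all only: q_eval_mult modular_seriesD Im_minus_inverse_pos power_add mult_ac)

lemma modular_series_mult':
  "F \<in> modular_series v \<Longrightarrow> G \<in> modular_series w \<Longrightarrow> u = v + w \<Longrightarrow> F * G \<in> modular_series u"
  using modular_series_mult by blast

lemma modular_series_const: "fps_const c \<in> modular_series 0"
  by (auto intro!: modular_seriesI)

lemma modular_series_cmult: "F \<in> modular_series w \<Longrightarrow> fps_const c * F \<in> modular_series w"
  using modular_series_mult[OF modular_series_const] by force

lemma modular_series_power: "F \<in> modular_series w \<Longrightarrow> F ^ n \<in> modular_series (n * w)"
  using modular_series_const[of 1]
  by (induction n) (auto dest: modular_series_mult)

definition E2_series :: "complex fps" where
  "E2_series = Abs_fps (\<lambda>n. if n = 0 then 1 else - 24 * of_nat (divisor_power_sum 1 n))"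

lemma has_q_expansion_Eisenstein_E2: "has_q_expansion Eisenstein_E2 (fps_nth E2_series)"
  unfolding has_q_expansion_def
proof
  fix z assume "z \<in> upper_half_plane"
  hence z: "Im z > 0" by (simp add: upper_half_plane_def)
  have "(\<lambda>n. -24 * (of_nat (divisor_power_sum 1 (Suc n)) * q_param z ^ Suc n)) sums (-24 * ((1 - Eisenstein_E2 z) / 24))"
    by (intro sums_mult Eisenstein_E2_csc2(2) z)
  also have "-24 * ((1 - Eisenstein_E2 z) / 24) = Eisenstein_E2 z - 1" by (simp add: field_simps)
  finally have "(\<lambda>n. fps_nth E2_series (Suc n) * q_param z ^ Suc n) sums (Eisenstein_E2 z - 1)"
    by (simp add: E2_series_def mult_ac)
  thus "(\<lambda>n. fps_nth E2_series n * q_param z ^ n) sums Eisenstein_E2 z"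
    by (subst (asm) sums_Suc_iff) (simp add: E2_series_def)
qed

lemma q_series_E2: "q_series E2_series"
  and q_eval_E2: "Im z > 0 \<Longrightarrow> q_eval E2_series z = Eisenstein_E2 z"
  using has_q_expansion_Eisenstein_E2
  by (simp_all add: has_q_expansion_iff fps_nth_inverse upper_half_plane_def)

lemma q_eval_E2_inversion:
  "Im z > 0 \<Longrightarrow> q_eval E2_series (- 1 / z) = z\<^sup>2 * q_eval E2_series z + 6 * z / (\<i> * of_real pi)"
  by (simp only: q_eval_E2 Im_minus_inverse_pos Eisenstein_E2_inversion)

definition serre_deriv :: "nat \<Rightarrow> complex fps \<Rightarrow> complex fps" where
  "serre_deriv w F = q_deriv F - fps_const (of_nat w / 12) * E2_series * F"

lemma q_eval_q_deriv_inversion: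
  assumes F: "F \<in> modular_series w" and z: "Im z > 0"
  shows "q_eval (q_deriv F) (- 1 / z) =
    z ^ (w + 2) * q_eval (q_deriv F) z + of_nat w * z ^ (w + 1) * q_eval F z / (2 * of_real pi * \<i>)"
proof -
  have z0: "z \<noteq> 0" using z by auto
  note q = modular_seriesD(1)[OF F]
  have "((\<lambda>z. q_eval F (- 1 / z)) has_field_derivative
      2 * of_real pi * \<i> * q_eval (q_deriv F) (- 1 / z) * (1 / z\<^sup>2)) (at z)"
    by (rule DERIV_chain2[OF q_eval_has_field_derivative[OF q] inversion_has_field_derivative])
       (use z Im_minus_inverse_pos[OF z] in simp_all)
  hence "((\<lambda>z. z ^ w * q_eval F z) has_field_derivative
      2 * of_real pi * \<i> * q_eval (q_deriv F) (- 1 / z) * (1 / z\<^sup>2)) (at z)"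
    by (rule DERIV_cong_ev[THEN iffD1, OF refl _ refl, rotated])
       (rule eventually_mono[OF eventually_nhds_Im_pos[OF z]], rule modular_seriesD(2)[OF F])
  moreover have "((\<lambda>z. z ^ w * q_eval F z) has_field_derivative
      of_nat w * z ^ (w - 1) * q_eval F z + z ^ w * (2 * of_real pi * \<i> * q_eval (q_deriv F) z)) (at z)"
    by (rule derivative_eq_intros q_eval_has_field_derivative[OF q z] refl)+ (simp add: mult_ac)
  ultimately have "2 * of_real pi * \<i> * q_eval (q_deriv F) (- 1 / z) * (1 / z\<^sup>2) =
     of_nat w * z ^ (w - 1) * q_eval F z + z ^ w * (2 * of_real pi * \<i> * q_eval (q_deriv F) z)"
    by (rule DERIV_unique)
  hence "2 * of_real pi * \<i> * q_eval (q_deriv F) (- 1 / z) * (1 / z\<^sup>2) * z\<^sup>2 =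
     (of_nat w * z ^ (w - 1) * q_eval F z + z ^ w * (2 * of_real pi * \<i> * q_eval (q_deriv F) z)) * z\<^sup>2"
    by (simp only:)
  also have "\<dots> = 2 * of_real pi * \<i> * (z ^ (w + 2) * q_eval (q_deriv F) z +
      of_nat w * (z ^ (w - 1) * z\<^sup>2) * q_eval F z / (2 * of_real pi * \<i>))"
    by (simp add: field_simps power_add power2_eq_square)
  \<comment> \<open>For w = 0 the exponent \<open>w - 1\<close> is truncated, but then the factor w
    vanishes.\<close>
  also have "of_nat w * (z ^ (w - 1) * z\<^sup>2) = of_nat w * z ^ (w + 1)"
    by (cases w) (simp_all add: power2_eq_square)
  finally have "2 * of_real pi * \<i> * q_eval (q_deriv F) (- 1 / z) = 2 * of_real pi * \<i> *
     (z ^ (w + 2) * q_eval (q_deriv F) z + of_nat w * z ^ (w + 1) * q_eval F z / (2 * of_real pi * \<i>))"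
    using z0 by simp
  thus ?thesis by (subst (asm) mult_cancel_left) simp
qed

text \<open>Differentiation adds w z^(w+1) F / (2 pi i) to the transformation law; w/12 times the
  extra term 6 z / (pi i) of E_2 produces the same amount.\<close>

lemma serre_deriv_modular:
  assumes F: "F \<in> modular_series w"
  shows "serre_deriv w F \<in> modular_series (w + 2)"
proof (rule modular_seriesI)
  note q = modular_seriesD(1)[OF F]
  note qs = q q_series_q_deriv[OF q] q_series_E2 q_series_mult q_series_diff q_series_const
  show "q_series (serre_deriv w F)" unfolding serre_deriv_def by (intro qs)
  have ev: "q_eval (serre_deriv w F) z = q_eval (q_deriv F) z - of_nat w / 12 * q_eval E2_series z * q_eval F z"
    if "Im z > 0" for z
    unfolding serre_deriv_def using that by (simp add: q_eval_diff q_eval_mult qs)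
  fix z assume z: "Im z > 0"
  show "q_eval (serre_deriv w F) (- 1 / z) = z ^ (w + 2) * q_eval (serre_deriv w F) z"
    unfolding ev[OF z] ev[OF Im_minus_inverse_pos[OF z]] q_eval_q_deriv_inversion[OF F z]
      q_eval_E2_inversion[OF z] modular_seriesD(2)[OF F z]
    by (simp add: field_simps power_add power2_eq_square)
qed

text \<open>
  Ramanujan's differential equations for \<open>E\<^sub>2\<close> and \<open>E\<^sub>4\<close> serve as definitions of \<open>E\<^sub>4\<close> and \<open>E\<^sub>6\<close>; this makes the
  integrality of their coefficients evident, and only the transformation law of \<open>E\<^sub>2\<close> is needed.
\<close>

definition E4_series :: "complex fps" where
  "E4_series = E2_series * E2_series - fps_const 12 * q_deriv E2_series"

definition E6_series :: "complex fps" where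
  "E6_series = E2_series * E4_series - fps_const 3 * q_deriv E4_series"

text \<open>In E_2^2 the extra term 6 z / (pi i) leaves its square and a cross term with E_2.
  Differentiating the law of E_2 and multiplying by 12 reproduces both, which is what fixes the
  factor 12.\<close>

lemma E4_series_modular: "E4_series \<in> modular_series 4"
proof (rule modular_seriesI)
  note qs = q_series_q_deriv[OF q_series_E2] q_series_E2 q_series_mult q_series_diff q_series_const
  show "q_series E4_series" unfolding E4_series_def by (intro qs)
  let ?P = "q_eval E2_series" and ?P' = "q_eval (q_deriv E2_series)"
  have ev: "q_eval E4_series z = ?P z * ?P z - 12 * ?P' z" if "Im z > 0" for z
    unfolding E4_series_def using that by (simp add: q_eval_diff q_eval_mult qs)
  fix z assume z: "Im z > 0"
  hence z0: "z \<noteq> 0" by auto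
  have "((\<lambda>z. ?P (- 1 / z)) has_field_derivative 2 * of_real pi * \<i> * ?P' (- 1 / z) * (1 / z\<^sup>2)) (at z)"
    by (rule DERIV_chain2[OF q_eval_has_field_derivative[OF q_series_E2] inversion_has_field_derivative])
       (use z Im_minus_inverse_pos[OF z] in simp_all)
  hence "((\<lambda>z. z\<^sup>2 * ?P z + 6 * z / (\<i> * of_real pi)) has_field_derivative
      2 * of_real pi * \<i> * ?P' (- 1 / z) * (1 / z\<^sup>2)) (at z)"
    by (rule DERIV_cong_ev[THEN iffD1, OF refl _ refl, rotated])
       (rule eventually_mono[OF eventually_nhds_Im_pos[OF z]], rule q_eval_E2_inversion)
  moreover have "((\<lambda>z. z\<^sup>2 * ?P z + 6 * z / (\<i> * of_real pi)) has_field_derivative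
      2 * z * ?P z + z\<^sup>2 * (2 * of_real pi * \<i> * ?P' z) + 6 / (\<i> * of_real pi)) (at z)"
    by (rule derivative_eq_intros q_eval_has_field_derivative[OF q_series_E2 z] refl)+ simp_all
  ultimately have "2 * of_real pi * \<i> * ?P' (- 1 / z) * (1 / z\<^sup>2) =
     2 * z * ?P z + z\<^sup>2 * (2 * of_real pi * \<i> * ?P' z) + 6 / (\<i> * of_real pi)"
    by (rule DERIV_unique)
  hence "2 * of_real pi * \<i> * ?P' (- 1 / z) * (1 / z\<^sup>2) * z\<^sup>2 =
     (2 * z * ?P z + z\<^sup>2 * (2 * of_real pi * \<i> * ?P' z) + 6 / (\<i> * of_real pi)) * z\<^sup>2"
    by (simp only:)
  also have "\<dots> = 2 * of_real pi * \<i> * (z ^ 3 * ?P z / (of_real pi * \<i>) + z ^ 4 * ?P' z - 3 * z\<^sup>2 / of_real pi ^ 2)"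
    by (simp add: field_simps power2_eq_square power3_eq_cube power4_eq_xxxx)
  finally have "2 * of_real pi * \<i> * ?P' (- 1 / z) = 2 * of_real pi * \<i> *
     (z ^ 3 * ?P z / (of_real pi * \<i>) + z ^ 4 * ?P' z - 3 * z\<^sup>2 / of_real pi ^ 2)"
    using z0 by simp
  hence P': "?P' (- 1 / z) = z ^ 3 * ?P z / (of_real pi * \<i>) + z ^ 4 * ?P' z - 3 * z\<^sup>2 / of_real pi ^ 2"
    by (subst (asm) mult_cancel_left) simp
  show "q_eval E4_series (- 1 / z) = z ^ 4 * q_eval E4_series z"
    unfolding ev[OF z] ev[OF Im_minus_inverse_pos[OF z]] P' q_eval_E2_inversion[OF z]
    by (simp add: field_simps power2_eq_square power3_eq_cube power4_eq_xxxx)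
qed

lemma E6_series_modular: "E6_series \<in> modular_series 6"
proof -
  have "E6_series = fps_const (-3) * serre_deriv 4 E4_series"
    by (simp add: E6_series_def serre_deriv_def algebra_simps flip: fps_const_neg)
  moreover have "serre_deriv 4 E4_series \<in> modular_series (4 + 2)"
    by (intro serre_deriv_modular E4_series_modular)
  ultimately show ?thesis
    using modular_series_cmult[of "serre_deriv 4 E4_series" 6 "-3"] by simp
qed

section \<open>The discriminant as a nowhere vanishing function\<close>

definition disc_exponent :: "complex fps" where
  "disc_exponent = Abs_fps (\<lambda>n. fps_nth E2_series n / of_nat n)"

text \<open>
  The discriminant as \<open>q exp (- 24 \<Sum> \<sigma>\<^sub>1(n)/n q\<^sup>n)\<close>: in this form it visibly has no zeros, and its
  logarithmic derivative is \<open>E\<^sub>2\<close>. The constant coefficient of the exponent is \<open>1/0 = 0\<close>.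
\<close>

definition disc :: "complex \<Rightarrow> complex" where
  "disc z = q_param z * exp (q_eval disc_exponent z)"

lemma disc_nonzero [simp]: "disc z \<noteq> 0"
  by (simp add: disc_def)

lemma q_series_disc_exponent: "q_series disc_exponent"
  unfolding q_series_def fps_conv_radius_def
proof (rule conv_radius_geI_ex')
  fix r :: real assume r: "0 < r" "ereal r < 1"
  have "summable (\<lambda>n. norm (fps_nth E2_series n * of_real r ^ n))"
    using less_le_trans[OF r(2) q_series_E2[unfolded q_series_def]] r(1) by (intro norm_summable_fps) simp
  thus "summable (\<lambda>n. fps_nth disc_exponent n * of_real r ^ n)"
  proof (rule summable_comparison_test'[of _ 0])
    fix n :: nat
    have "norm (x / of_nat n) \<le> norm x" for x :: complex
      by (cases n) (auto simp: norm_divide divide_le_eq mult_left_le norm_of_nat simp del: of_nat_Suc intro: order.trans[OF _ mult_left_mono[of 1 _ "norm x"]])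
    from this[of "fps_nth E2_series n * of_real r ^ n"]
    show "norm (fps_nth disc_exponent n * of_real r ^ n) \<le> norm (fps_nth E2_series n * of_real r ^ n)"
      by (simp add: disc_exponent_def)
  qed
qed

lemma q_deriv_disc_exponent: "q_deriv disc_exponent = E2_series - 1"
  by (rule fps_ext) (simp add: disc_exponent_def E2_series_def)

lemma disc_has_field_derivative:
  assumes z: "Im z > 0"
  shows "(disc has_field_derivative 2 * of_real pi * \<i> * q_eval E2_series z * disc z) (at z)"
proof -
  have eq: "q_eval (q_deriv disc_exponent) z = q_eval E2_series z - 1"
    unfolding q_deriv_disc_exponent using q_eval_diff[OF q_series_E2 q_series_const[of 1] z] q_eval_const[of 1 z] by simp
  show ?thesis unfolding disc_def
    by (auto intro!: derivative_eq_intros q_eval_has_field_derivative[OF q_series_disc_exponent z]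
        simp: eq algebra_simps)
qed

text \<open>Both sides have the same logarithmic derivative: the extra term of E_2 contributes 12 /
  z, which is that of z^12. Hence their quotient is constant.\<close>

lemma disc_inversion:
  assumes z: "Im z > 0"
  shows "disc (- 1 / z) = z ^ 12 * disc z"
proof -
  let ?h = "\<lambda>z. disc (- 1 / z) / (z ^ 12 * disc z)"
  have "\<exists>c. \<forall>z\<in>{z. Im z > 0}. ?h z = c"
  proof (rule has_field_derivative_zero_constant)
    show "convex {z. Im z > 0}" by (rule convex_halfspace_Im_gt)
    fix z assume "z \<in> {z. Im z > 0}"
    hence z: "Im z > 0" by simp
    hence z0: "z \<noteq> 0" by auto
    have 1: "((\<lambda>z. disc (- 1 / z)) has_field_derivative
        (2 * of_real pi * \<i> * q_eval E2_series (- 1 / z) * disc (- 1 / z)) * (1 / z\<^sup>2)) (at z)"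
      by (rule DERIV_chain2[OF disc_has_field_derivative inversion_has_field_derivative])
         (use z Im_minus_inverse_pos[OF z] in simp_all)
    define A where "A = 2 * of_real pi * \<i> * q_eval E2_series z"
    have "2 * of_real pi * \<i> * q_eval E2_series (- 1 / z) * (1 / z\<^sup>2) = A + 12 / z"
      unfolding q_eval_E2_inversion[OF z] A_def using z0 by (simp add: field_simps power2_eq_square)
    hence 1: "((\<lambda>z. disc (- 1 / z)) has_field_derivative (A + 12 / z) * disc (- 1 / z)) (at z)"
      using 1 by (metis mult.assoc mult.commute)
    have 2: "((\<lambda>z. z ^ 12 * disc z) has_field_derivative (A + 12 / z) * (z ^ 12 * disc z)) (at z)"
      unfolding A_def using z0
      by (auto intro!: derivative_eq_intros disc_has_field_derivative z simp: field_simps eval_nat_numeral)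
    have "(?h has_field_derivative
        ((A + 12 / z) * disc (- 1 / z) * (z ^ 12 * disc z) - disc (- 1 / z) * ((A + 12 / z) * (z ^ 12 * disc z))) /
         ((z ^ 12 * disc z) * (z ^ 12 * disc z))) (at z)"
      by (rule DERIV_divide[OF 1 2]) (use z0 in simp)
    thus "(?h has_field_derivative 0) (at z within {z. Im z > 0})"
      by (simp add: mult_ac has_field_derivative_at_within)
  qed
  then obtain c where c: "\<And>z. Im z > 0 \<Longrightarrow> ?h z = c" by auto
  \<comment> \<open>The fixed point i of the inversion determines the constant.\<close>
  have "\<i> ^ 12 = (\<i>\<^sup>2) ^ 6" by (simp only: power_mult[symmetric]) simp
  hence "\<i> ^ 12 = 1" by simp
  hence "c = 1" using c[of \<i>] by (simp add: divide_complex_def)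
  with c[OF z] z show ?thesis by (auto simp: field_simps)
qed

section \<open>Bound on the order of vanishing at the cusp\<close>

lemma exists_translate_strip:
  fixes z :: complex
  obtains n :: int where "\<bar>Re (z + of_int n)\<bar> \<le> 1 / 2"
proof
  show "\<bar>Re (z + of_int (- round (Re z)))\<bar> \<le> 1 / 2"
    using of_int_round_abs_le[of "Re z"] by (simp add: abs_minus_commute)
qed

lemma Im_inversion_ge_double:
  assumes "0 < Im z" "Im z \<le> 1 / 2" "\<bar>Re z\<bar> \<le> 1 / 2"
  shows "Im (- 1 / z) \<ge> 2 * Im z"
proof -
  have "(Re z)\<^sup>2 \<le> (1 / 2)\<^sup>2" "(Im z)\<^sup>2 \<le> (1 / 2)\<^sup>2"
    using assms abs_le_square_iff[of "Re z" "1/2"] by (auto intro!: power_mono)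
  hence le: "(Re z)\<^sup>2 + (Im z)\<^sup>2 \<le> 1 / 2" by (simp add: power2_eq_square)
  have pos: "(Re z)\<^sup>2 + (Im z)\<^sup>2 > 0" using assms by (intro add_nonneg_pos) auto
  have "2 * Im z * ((Re z)\<^sup>2 + (Im z)\<^sup>2) \<le> 2 * Im z * (1 / 2)"
    using assms le by (intro mult_left_mono) auto
  hence "2 * Im z \<le> Im z / ((Re z)\<^sup>2 + (Im z)\<^sup>2)" using pos by (simp add: pos_le_divide_eq)
  thus ?thesis by (simp add: Im_divide)
qed

text \<open>In the strip, inversion at least doubles an imaginary part not exceeding 1/2, so the
  number of steps is bounded in terms of Im z. Settling for height 1/2 instead of the exact
  fundamental domain spares a search for the highest point of the orbit.\<close>

lemma modular_reduction:
  assumes T: "\<And>z n. Im z > 0 \<Longrightarrow> h (z + of_int n) = h z"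
    and S: "\<And>z. Im z > 0 \<Longrightarrow> h (- 1 / z) = h z"
    and z: "Im z > 0"
  obtains z' where "\<bar>Re z'\<bar> \<le> 1 / 2" "Im z' \<ge> 1 / 2" "h z' = h z"
proof -
  have "\<exists>z'. \<bar>Re z'\<bar> \<le> 1 / 2 \<and> Im z' \<ge> 1 / 2 \<and> h z' = h z" if "Im z > 0" "Im z * 2 ^ n \<ge> 1 / 2" for n z
    using that
  proof (induction n arbitrary: z)
    case 0
    obtain n :: int where "\<bar>Re (z + of_int n)\<bar> \<le> 1 / 2" by (rule exists_translate_strip)
    thus ?case using 0 T[of z n] by (intro exI[of _ "z + of_int n"]) simp
  next
    case (Suc k)
    obtain n :: int where n: "\<bar>Re (z + of_int n)\<bar> \<le> 1 / 2" by (rule exists_translate_strip)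
    define u where "u = z + of_int n"
    have u: "Im u = Im z" "h u = h z" "\<bar>Re u\<bar> \<le> 1 / 2" using n T[of z n] Suc.prems by (simp_all add: u_def)
    show ?case
    proof (cases "Im u \<ge> 1 / 2")
      case True
      thus ?thesis using u by blast
    next
      case False
      have 2: "Im (- 1 / u) \<ge> 2 * Im u" using False u Suc.prems by (intro Im_inversion_ge_double) auto
      have "1 / 2 \<le> 2 * Im u * 2 ^ k" using Suc.prems u by (simp add: mult_ac)
      also have "\<dots> \<le> Im (- 1 / u) * 2 ^ k" using 2 by (intro mult_right_mono) auto
      finally have "\<exists>z'. \<bar>Re z'\<bar> \<le> 1 / 2 \<and> Im z' \<ge> 1 / 2 \<and> h z' = h (- 1 / u)"
        using Im_minus_inverse_pos[of u] u Suc.prems by (intro Suc.IH) simp_all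
      thus ?thesis using S[of u] u Suc.prems by simp
    qed
  qed
  moreover obtain n where "1 / 2 / Im z < 2 ^ n" using real_arch_pow[of 2 "1 / 2 / Im z"] by auto
  hence "Im z * 2 ^ n \<ge> 1 / 2" using z by (simp add: field_simps)
  ultimately show ?thesis using z that by blast
qed

text \<open>
  Every orbit meets the strip \<open>\<bar>Re z\<bar> \<le> 1/2\<close>, \<open>Im z \<ge> 1/2\<close>, so the modulus attains its maximum there
  and the maximum modulus principle applies.
\<close>

lemma modular_function_vanishes:
  assumes hol: "h holomorphic_on {z. Im z > 0}"
    and T: "\<And>z n. Im z > 0 \<Longrightarrow> h (z + of_int n) = h z"
    and S: "\<And>z. Im z > 0 \<Longrightarrow> h (- 1 / z) = h z"
    and cusp: "\<And>\<epsilon>. \<epsilon> > 0 \<Longrightarrow> \<exists>Y. \<forall>z. Im z > Y \<longrightarrow> norm (h z) < \<epsilon>"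
    and z: "Im z > 0"
  shows "h z = 0"
proof (rule ccontr)
  assume nz: "h z \<noteq> 0"
  then obtain Y where Y: "\<And>w. Im w > Y \<Longrightarrow> norm (h w) < norm (h z)" using cusp[of "norm (h z)"] by auto
  define K where "K = cbox (Complex (-1/2) (1/2)) (Complex (1/2) (max Y (1/2)))"
  have K: "w \<in> K \<longleftrightarrow> \<bar>Re w\<bar> \<le> 1/2 \<and> Im w \<ge> 1/2 \<and> Im w \<le> max Y (1/2)" for w
    unfolding K_def by (auto simp: in_cbox_complex_iff)
  obtain z' where z': "\<bar>Re z'\<bar> \<le> 1 / 2" "Im z' \<ge> 1 / 2" "h z' = h z"
    using modular_reduction[of h, OF T S z] by blast
  hence z'K: "z' \<in> K" using Y[of z'] K by force
  have "continuous_on K (\<lambda>w. norm (h w))"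
    by (intro continuous_on_norm continuous_on_subset[OF holomorphic_on_imp_continuous_on[OF hol]]) (auto simp: K)
  moreover have "compact K" by (simp add: K_def)
  ultimately obtain w where w: "w \<in> K" "\<And>u. u \<in> K \<Longrightarrow> norm (h u) \<le> norm (h w)"
    using continuous_attains_sup[of K "\<lambda>w. norm (h w)"] z'K by auto
  have max: "norm (h u) \<le> norm (h w)" if u: "Im u > 0" for u
  proof -
    obtain u' where u': "\<bar>Re u'\<bar> \<le> 1 / 2" "Im u' \<ge> 1 / 2" "h u' = h u"
      using modular_reduction[of h, OF T S u] by blast
    show ?thesis
    proof (cases "u' \<in> K")
      case True
      thus ?thesis using w(2) u'(3) by metis
    next
      case False
      hence "Im u' > Y" using u' by (auto simp: K)
      hence "norm (h u') < norm (h z')" using Y z'(3) by simp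
      also have "\<dots> \<le> norm (h w)" using w(2) z'K by blast
      finally show ?thesis using u'(3) by simp
    qed
  qed
  have "h constant_on {z. Im z > 0}"
  proof (rule maximum_modulus_principle[OF hol])
    show "w \<in> {z. Im z > 0}" using w(1) by (simp add: K)
  qed (use max in \<open>auto simp: open_halfspace_Im_gt intro!: convex_connected convex_halfspace_Im_gt\<close>)
  then obtain c where c: "\<And>u. Im u > 0 \<Longrightarrow> h u = c" by (auto simp: constant_on_def)
  have "h (Complex 0 (max Y 1 + 1)) = h z" using c z by simp
  moreover have "norm (h (Complex 0 (max Y 1 + 1))) < norm (h z)" by (rule Y) simp
  ultimately show False by simp
qed

lemma q_param_add_int: "q_param (z + of_int n) = q_param z"
proof -
  have "exp (2 * of_real pi * \<i> * of_int n) = 1"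
    using exp_integer_2pi[of "of_int n"] by (simp add: mult_ac)
  thus ?thesis by (simp add: q_param_def algebra_simps exp_add)
qed

lemma q_eval_add_int: "q_eval F (z + of_int n) = q_eval F z"
  by (simp add: q_eval_def q_param_add_int)

lemma q_series_conv_radius_pos: "q_series F \<Longrightarrow> ereal 0 < fps_conv_radius F"
  unfolding q_series_def by (rule less_le_trans) simp_all

lemma holomorphic_q_eval: "q_series F \<Longrightarrow> q_eval F holomorphic_on {z. Im z > 0}"
  using q_eval_has_field_derivative by (auto simp: holomorphic_on_open open_halfspace_Im_gt)

lemma holomorphic_disc: "disc holomorphic_on {z. Im z > 0}"
  using disc_has_field_derivative by (auto simp: holomorphic_on_open open_halfspace_Im_gt)

text \<open>F^12 / disc^w is invariant, holomorphic because \<open>disc\<close> has no zeros, and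
  O(q^(12 r - w)) at the cusp, hence 0. Clearing the weight by a twelfth power avoids counting zeros
  in a fundamental domain.\<close>

theorem modular_series_eq_0:
  assumes F: "F \<in> modular_series w" and r: "\<And>n. n < r \<Longrightarrow> fps_nth F n = 0" and rw: "w < 12 * r"
  shows "F = 0"
proof (rule ccontr)
  assume nz: "F \<noteq> 0"
  note q = modular_seriesD(1)[OF F]
  have deg: "r \<le> subdegree F" using nz r by (meson not_le nth_subdegree_nonzero)
  define G where "G = fps_shift r F"
  have G: "F = G * fps_X ^ r" unfolding G_def using deg by (simp add: fps_shift_times_fps_X_power)
  have qG: "q_series G" using q by (simp add: q_series_def G_def)
  have FG: "q_eval F z = q_eval G z * q_param z ^ r" if "Im z > 0" for z
    unfolding q_eval_def by (subst G, subst eval_fps_mult) (use q_series_norm[OF qG that] in auto)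
  define h where "h = (\<lambda>z. q_eval F z ^ 12 / disc z ^ w)"
  have "h z = 0" if z: "Im z > 0" for z
  proof (rule modular_function_vanishes[OF _ _ _ _ z])
    show "h holomorphic_on {z. Im z > 0}" unfolding h_def
      by (intro holomorphic_intros holomorphic_q_eval q holomorphic_disc) simp
    show "h (z + of_int n) = h z" for z n
      by (simp add: h_def disc_def q_eval_add_int q_param_add_int)
    show "h (- 1 / z) = h z" if "Im z > 0" for z
    proof -
      have "z \<noteq> 0" using that by auto
      thus ?thesis unfolding h_def modular_seriesD(2)[OF F that] disc_inversion[OF that]
        by (simp add: power_mult_distrib mult.commute flip: power_mult)
    qed
    fix \<epsilon> :: real assume \<epsilon>: "\<epsilon> > 0"
    \<comment> \<open>This is h as a function of q; cancelling the powers of q from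
      \<open>disc\<close> leaves a positive exponent, so k is continuous at 0 with value 0.\<close>
    define k where "k = (\<lambda>x. x ^ (12 * r - w) * eval_fps G x ^ 12 / exp (eval_fps disc_exponent x) ^ w)"
    have hk: "h z = k (q_param z)" if "Im z > 0" for z
    proof -
      have "q_param z ^ (12 * r) = q_param z ^ (12 * r - w) * q_param z ^ w"
        using rw by (simp flip: power_add)
      thus ?thesis unfolding h_def k_def FG[OF that] disc_def
        by (simp add: power_mult_distrib mult.commute flip: power_mult q_eval_def)
    qed
    have "isCont k 0" unfolding k_def
      by (intro continuous_intros)
         (use q_series_conv_radius_pos[OF qG] q_series_conv_radius_pos[OF q_series_disc_exponent] in auto)
    moreover have "k 0 = 0" using rw by (simp add: k_def)
    ultimately obtain \<delta> where \<delta>: "\<delta> > 0" "\<And>x. norm x < \<delta> \<Longrightarrow> norm (k x) < \<epsilon>"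
      using \<epsilon> unfolding continuous_at_eps_delta by (metis dist_0_norm dist_commute)
    show "\<exists>Y. \<forall>z. Im z > Y \<longrightarrow> norm (h z) < \<epsilon>"
    proof (intro exI allI impI)
      fix z assume z: "Im z > max 0 (- ln \<delta> / (2 * pi))"
      hence "- 2 * pi * Im z < ln \<delta>" by (simp add: field_simps)
      hence "norm (q_param z) < \<delta>" unfolding norm_q_param using \<delta>(1) by (metis exp_less_cancel_iff exp_ln)
      thus "norm (h z) < \<epsilon>" using \<delta>(2) hk z by simp
    qed
  qed
  hence "q_eval F z = q_eval 0 z" if "Im z > 0" for z using that by (simp add: h_def)
  hence "F = 0" by (intro q_eval_inj q) auto
  with nz show False by contradiction
qed

section \<open>Low coefficients and Ramanujan's equations\<close>

lemma numeral_fps_const': "fps_const (numeral n) = numeral n"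
  by (simp add: numeral_fps_const)

lemma q_deriv_numeral: "q_deriv (numeral n) = 0"
  unfolding numeral_fps_const by (rule q_deriv_const)

lemma E2_series_nth: "fps_nth E2_series 0 = 1" "fps_nth E2_series 1 = - 24" "fps_nth E2_series 2 = - 72"
proof -
  have "d = 1 \<or> d = 2" if "d dvd 2" for d :: nat
    using that two_is_prime_nat by (metis prime_nat_iff)
  hence "{d. d dvd (2::nat)} = {1, 2}" by auto
  thus "fps_nth E2_series 0 = 1" "fps_nth E2_series 1 = - 24" "fps_nth E2_series 2 = - 72"
    by (simp_all add: E2_series_def divisor_power_sum_def)
qed

lemma fps_mult_nth_2': "fps_nth (F * G) 2 = fps_nth F 0 * fps_nth G 2 + fps_nth F 1 * fps_nth G 1 + fps_nth F 2 * fps_nth G 0"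
  for F G :: "'a::comm_ring_1 fps"
  by (simp add: fps_mult_nth numeral_2_eq_2)

lemma E4_series_nth: "fps_nth E4_series 0 = 1" "fps_nth E4_series 1 = 240" "fps_nth E4_series 2 = 2160"
  by (simp_all add: E4_series_def fps_mult_nth_2' fps_mult_nth_1 E2_series_nth[unfolded One_nat_def] E2_series_nth)

lemma E6_series_nth: "fps_nth E6_series 0 = 1" "fps_nth E6_series 1 = - 504" "fps_nth E6_series 2 = - 16632"
  by (simp_all add: E6_series_def fps_mult_nth_2' fps_mult_nth_1 E2_series_nth[unfolded One_nat_def] E2_series_nth
    E4_series_nth[unfolded One_nat_def] E4_series_nth)

lemma q_deriv_E2: "12 * q_deriv E2_series = E2_series * E2_series - E4_series"
  by (simp add: E4_series_def numeral_fps_const')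

lemma q_deriv_E4: "3 * q_deriv E4_series = E2_series * E4_series - E6_series"
  by (simp add: E6_series_def numeral_fps_const')

text \<open>Unlike the other two equations this one does not hold by definition: half the difference
  of its sides is modular of weight 8 < 12 with constant term - 1/2 + 1/2, hence 0.\<close>

lemma q_deriv_E6: "2 * q_deriv E6_series = E2_series * E6_series - E4_series * E4_series"
proof -
  have "serre_deriv 6 E6_series \<in> modular_series (6 + 2)" "E4_series * E4_series \<in> modular_series (4 + 4)"
    by (intro serre_deriv_modular modular_series_mult E4_series_modular E6_series_modular)+
  hence "serre_deriv 6 E6_series + fps_const (1/2) * (E4_series * E4_series) \<in> modular_series 8"
    by (intro modular_series_add modular_series_cmult) simp_all
  moreover have "fps_nth (serre_deriv 6 E6_series + fps_const (1/2) * (E4_series * E4_series)) 0 = 0"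
    by (simp add: serre_deriv_def E2_series_nth E4_series_nth E6_series_nth)
  ultimately have "serre_deriv 6 E6_series + fps_const (1/2) * (E4_series * E4_series) = 0"
    by (intro modular_series_eq_0[of _ 8 1]) auto
  hence "2 * (serre_deriv 6 E6_series + fps_const (1/2) * (E4_series * E4_series)) = 0" by simp
  moreover have "2 * fps_const (1/2) = (1 :: complex fps)"
    by (simp add: fps_eq_iff fps_const_mult[symmetric] flip: numeral_fps_const')
  ultimately show ?thesis
    by (simp add: serre_deriv_def algebra_simps flip: mult.assoc)
qed

definition Delta_series :: "complex fps" where
  "Delta_series = fps_const (1 / 1728) * (E4_series ^ 3 - E6_series ^ 2)"

lemma Delta_series_eq: "1728 * Delta_series = E4_series ^ 3 - E6_series ^ 2"
  unfolding Delta_series_def numeral_fps_const'[symmetric] mult.assoc[symmetric] fps_const_mult by simp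

lemma Delta_series_modular: "Delta_series \<in> modular_series 12"
  unfolding Delta_series_def
  using modular_series_power[OF E4_series_modular, of 3] modular_series_power[OF E6_series_modular, of 2]
  by (intro modular_series_cmult modular_series_diff) simp_all

lemma Delta_series_nth: "fps_nth Delta_series 0 = 0" "fps_nth Delta_series 1 = 1" "fps_nth Delta_series 2 = - 24"
  unfolding Delta_series_def power2_eq_square power3_eq_cube fps_mult_left_const_nth fps_sub_nth
    fps_mult_nth_0 fps_mult_nth_1 fps_mult_nth_2' E4_series_nth E6_series_nth by simp_all

lemma q_deriv_Delta: "q_deriv Delta_series = E2_series * Delta_series"
proof -
  have "1728 * q_deriv Delta_series = q_deriv (1728 * Delta_series)"
    by (simp add: q_deriv_mult q_deriv_numeral)
  also have "\<dots> = E4_series * E4_series * (3 * q_deriv E4_series) - E6_series * (2 * q_deriv E6_series)"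
    unfolding Delta_series_eq
    by (simp add: q_deriv_diff q_deriv_mult power2_eq_square power3_eq_cube algebra_simps)
  also have "\<dots> = E2_series * (1728 * Delta_series)"
    unfolding q_deriv_E4 q_deriv_E6 Delta_series_eq by (simp add: algebra_simps power2_eq_square power3_eq_cube)
  finally show ?thesis by simp
qed

section \<open>The extremal series\<close>

text \<open>
  The constant in the recursion normalizes the leading coefficient to \<open>1\<close>; all its prime factors
  divide \<open>12 (6k + 5) (6k + 13)\<close> and hence are smaller than the weight \<open>6k + 14\<close> of the new form.
\<close>

fun extremal_series :: "nat \<Rightarrow> complex fps" where
  "extremal_series 0 = E2_series"
| "extremal_series (Suc 0) = fps_const (1 / 1008) * (E4_series * E4_series - E2_series * E6_series)"
| "extremal_series (Suc (Suc k)) =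
     fps_const (- of_nat (Suc k * Suc (Suc k)) / of_nat (12 * (6 * k + 5) * (6 * k + 13))) *
       (E6_series * extremal_series (Suc k) - Delta_series * extremal_series k)"

declare extremal_series.simps(3) [simp del]

lemma extremal_series_1: "1008 * extremal_series (Suc 0) = E4_series * E4_series - E2_series * E6_series"
  by (simp add: mult.assoc[symmetric] numeral_fps_const)

text \<open>Denominators are cleared so that the recursion fits the integral domain of
  \<open>ladder_step\<close>.\<close>

lemma extremal_series_rec:
  "12 * (6 * of_nat k + 5) * (6 * of_nat k + 13) * extremal_series (Suc (Suc k)) =
     - ((of_nat k + 1) * (of_nat k + 2) * (E6_series * extremal_series (Suc k) - Delta_series * extremal_series k))"
proof -
  define c where "c = complex_of_nat (12 * (6 * k + 5) * (6 * k + 13))"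
  define d where "d = complex_of_nat (Suc k * Suc (Suc k))"
  have c: "c \<noteq> 0" unfolding c_def by (simp only: of_nat_eq_0_iff) simp
  have "fps_const c * extremal_series (Suc (Suc k)) =
     fps_const (- d) * (E6_series * extremal_series (Suc k) - Delta_series * extremal_series k)"
    unfolding extremal_series.simps c_def[symmetric] d_def[symmetric] mult.assoc[symmetric] fps_const_mult
    using c by simp
  moreover have "fps_const c = 12 * (6 * of_nat k + 5) * (6 * of_nat k + 13)"
    unfolding c_def fps_of_nat by (simp only: of_nat_mult of_nat_add of_nat_numeral)
  moreover have "fps_const (- d) = - ((of_nat k + 1) * (of_nat k + 2))"
    unfolding d_def fps_const_neg[symmetric] fps_of_nat by (simp add: algebra_simps)
  ultimately show ?thesis by (simp only: minus_mult_left)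
qed

text \<open>
  The second identity of \<open>extremal_series_ladder\<close> determines the coefficient following the leading one,
  and with it the leading coefficient of the next form; the first one only carries the induction.
  \<open>ladder_step\<close> is the induction step, with \<open>P, Q, R, S\<close> in the roles of \<open>E\<^sub>2, E\<^sub>4, E\<^sub>6, \<Delta>\<close> and
  \<open>D0, D1, D2\<close> in those of the derivatives of \<open>f0, f1, f2\<close>.
\<close>

lemma ladder_step:
  fixes P Q R S DR DS f0 f1 f2 D0 D1 D2 k :: "'a :: idom"
  assumes S: "1728 * S = Q ^ 3 - R ^ 2" and DR: "2 * DR = P * R - Q * Q" and DS: "DS = P * S"
    and rec: "12 * (6 * k + 5) * (6 * k + 13) * f2 = - ((k + 1) * (k + 2) * (R * f1 - S * f0))"
    and rec': "12 * (6 * k + 5) * (6 * k + 13) * D2 = - ((k + 1) * (k + 2) * (DR * f1 + R * D1 - (DS * f0 + S * D0)))"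
    and up: "(k + 1) * (Q * (12 * D0 - (6 * k + 1) * P * f0)) = (k + 1) * (6 * k - 1) * R * f0 + 144 * (6 * k - 1) * (6 * k + 7) * f1"
    and down: "Q * (12 * D1 - (6 * k + 7) * P * f1) = - (6 * k + 7) * R * f1 + 12 * (k + 1) * S * f0"
    and nz: "12 * (6 * k + 5) * (6 * k + 13) \<noteq> 0"
  shows "Q * (12 * D2 - (6 * k + 13) * P * f2) = - (6 * k + 13) * R * f2 + 12 * (k + 2) * S * f1"
proof -
  define c where "c = 12 * (6 * k + 5) * (6 * k + 13)"
  \<comment> \<open>Y is Q times the operator 12 D - (6k + 13) P applied to
    \<open>R * f1 - S * f0\<close>.\<close>
  define Y where "Y = 12 * Q * (DR * f1 + R * D1 - (DS * f0 + S * D0)) - (6 * k + 13) * P * Q * (R * f1 - S * f0)"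
  have "c * (Q * (12 * D2 - (6 * k + 13) * P * f2)) = 12 * Q * (c * D2) - (6 * k + 13) * P * Q * (c * f2)"
    by (simp add: algebra_simps)
  also have "\<dots> = - ((k + 2) * ((k + 1) * Y))"
    unfolding c_def rec rec' Y_def by (simp add: algebra_simps)
  also have "Y = 6 * Q * f1 * (2 * DR) + R * (Q * (12 * D1 - (6 * k + 7) * P * f1))
      - S * (Q * (12 * D0 - (6 * k + 1) * P * f0)) - 12 * Q * f0 * DS
      + P * Q * (R * (6 * k + 7) * f1 - S * (6 * k + 1) * f0 - (6 * k + 13) * (R * f1 - S * f0))"
    unfolding Y_def by (simp add: algebra_simps)
  also have "\<dots> = R * (- (6 * k + 7) * R * f1 + 12 * (k + 1) * S * f0) - 6 * Q ^ 3 * f1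
      - S * (Q * (12 * D0 - (6 * k + 1) * P * f0))"
    unfolding DR DS down by (simp add: algebra_simps power3_eq_cube)
  also have "Q ^ 3 = 1728 * S + R ^ 2" using S by simp
  \<comment> \<open>The identity \<open>up\<close> is available only with the factor k + 1, which is
    therefore carried along.\<close>
  also have "(k + 1) * (R * (- (6 * k + 7) * R * f1 + 12 * (k + 1) * S * f0) - 6 * (1728 * S + R ^ 2) * f1
      - S * (Q * (12 * D0 - (6 * k + 1) * P * f0))) =
      (k + 1) * (R * (- (6 * k + 7) * R * f1 + 12 * (k + 1) * S * f0) - 6 * (1728 * S + R ^ 2) * f1)
      - S * ((k + 1) * (Q * (12 * D0 - (6 * k + 1) * P * f0)))"
    by (simp add: algebra_simps)
  also have "- ((k + 2) * \<dots>) =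
      - (6 * k + 13) * R * (- ((k + 1) * (k + 2) * (R * f1 - S * f0))) + c * (12 * (k + 2) * S * f1)"
    unfolding up c_def by (simp add: algebra_simps power2_eq_square)
  also have "\<dots> = c * (- (6 * k + 13) * R * f2 + 12 * (k + 2) * S * f1)"
    unfolding rec[symmetric] c_def by (simp add: algebra_simps)
  finally show ?thesis using nz unfolding c_def by simp
qed

lemma of_nat_linear_neq_0: "12 * (6 * of_nat k + 5) * (6 * of_nat k + 13) \<noteq> (0 :: complex fps)"
proof -
  have "12 * (6 * of_nat k + 5) * (6 * of_nat k + 13) = (of_nat (12 * (6 * k + 5) * (6 * k + 13)) :: complex fps)"
    by (simp only: of_nat_mult of_nat_add of_nat_numeral)
  thus ?thesis by (simp only: of_nat_eq_0_iff) simp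
qed

lemma q_deriv_of_nat: "q_deriv (of_nat n) = 0"
  unfolding fps_of_nat[symmetric] by (rule q_deriv_const)

lemma extremal_series_q_deriv_rec:
  "12 * (6 * of_nat k + 5) * (6 * of_nat k + 13) * q_deriv (extremal_series (Suc (Suc k))) =
     - ((of_nat k + 1) * (of_nat k + 2) *
        (q_deriv E6_series * extremal_series (Suc k) + E6_series * q_deriv (extremal_series (Suc k))
         - (q_deriv Delta_series * extremal_series k + Delta_series * q_deriv (extremal_series k))))"
proof -
  have c: "12 * (6 * of_nat k + 5) * (6 * of_nat k + 13) = (of_nat (12 * (6 * k + 5) * (6 * k + 13)) :: complex fps)"
    and d: "(of_nat k + 1) * (of_nat k + 2) = (of_nat ((k + 1) * (k + 2)) :: complex fps)"
    by (simp_all only: of_nat_mult of_nat_add of_nat_numeral of_nat_1)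
  have D: "q_deriv (of_nat n * F) = of_nat n * q_deriv F" for n F
    by (simp add: q_deriv_mult q_deriv_of_nat)
  have neg: "q_deriv (- F) = - q_deriv F" for F
    by (simp add: fps_eq_iff)
  have "q_deriv (of_nat (12 * (6 * k + 5) * (6 * k + 13)) * extremal_series (Suc (Suc k))) =
     q_deriv (- (of_nat ((k + 1) * (k + 2)) * (E6_series * extremal_series (Suc k) - Delta_series * extremal_series k)))"
    using extremal_series_rec[of k] unfolding c d by (simp only:)
  thus ?thesis unfolding D neg q_deriv_diff q_deriv_mult[of E6_series] q_deriv_mult[of Delta_series] c d .
qed

lemma extremal_series_ladder:
  "(of_nat k + 1) * (E4_series * (12 * q_deriv (extremal_series k) - (6 * of_nat k + 1) * E2_series * extremal_series k))
     = (of_nat k + 1) * (6 * of_nat k - 1) * E6_series * extremal_series k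
       + 144 * (6 * of_nat k - 1) * (6 * of_nat k + 7) * extremal_series (Suc k)" (is "?up k")
  "E4_series * (12 * q_deriv (extremal_series (Suc k)) - (6 * of_nat k + 7) * E2_series * extremal_series (Suc k))
     = - (6 * of_nat k + 7) * E6_series * extremal_series (Suc k)
       + 12 * (of_nat k + 1) * Delta_series * extremal_series k" (is "?down k")
proof (induction k)
  case 0
  let ?P = E2_series and ?Q = E4_series and ?R = E6_series and ?S = Delta_series
  have "?Q * (12 * q_deriv ?P - ?P * ?P) = - (?R * ?P) - 1008 * extremal_series (Suc 0)"
    unfolding extremal_series_1 q_deriv_E2 by (simp add: algebra_simps)
  thus "?up 0" by (simp add: algebra_simps)
  have D: "1008 * q_deriv (extremal_series (Suc 0)) = 2 * ?Q * q_deriv ?Q - (q_deriv ?P * ?R + ?P * q_deriv ?R)"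
  proof -
    have "1008 * q_deriv (extremal_series (Suc 0)) = q_deriv (1008 * extremal_series (Suc 0))"
      by (simp add: q_deriv_mult q_deriv_numeral)
    thus ?thesis unfolding extremal_series_1 by (simp add: q_deriv_diff q_deriv_mult algebra_simps)
  qed
  have "1008 * (?Q * (12 * q_deriv (extremal_series (Suc 0)) - 7 * ?P * extremal_series (Suc 0)))
     = ?Q * (12 * (1008 * q_deriv (extremal_series (Suc 0))) - 7 * ?P * (1008 * extremal_series (Suc 0)))"
    by (simp add: algebra_simps)
  also have "\<dots> = ?Q * (8 * ?Q * (3 * q_deriv ?Q) - ?R * (12 * q_deriv ?P) - 6 * ?P * (2 * q_deriv ?R)
      - 7 * ?P * (?Q * ?Q - ?P * ?R))"
    unfolding D extremal_series_1 by (simp add: algebra_simps)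
  also have "\<dots> = 7 * (?P * ?Q ^ 3 - ?Q * ?Q * ?R)"
    unfolding q_deriv_E2 q_deriv_E4 q_deriv_E6 by (simp add: algebra_simps power3_eq_cube)
  also have "?Q ^ 3 = 1728 * ?S + ?R ^ 2" using Delta_series_eq by simp
  also have "7 * (?P * (1728 * ?S + ?R ^ 2) - ?Q * ?Q * ?R) = - 7 * ?R * (?Q * ?Q - ?P * ?R) + 1008 * (12 * ?S * ?P)"
    by (simp add: algebra_simps power2_eq_square)
  also have "\<dots> = 1008 * (- 7 * ?R * extremal_series (Suc 0) + 12 * ?S * ?P)"
    unfolding extremal_series_1[symmetric] by (simp add: algebra_simps)
  finally have "?Q * (12 * q_deriv (extremal_series (Suc 0)) - 7 * ?P * extremal_series (Suc 0))
     = - 7 * ?R * extremal_series (Suc 0) + 12 * ?S * ?P"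
    by (subst (asm) mult_cancel_left) simp
  thus "?down 0" by simp
next
  case (Suc k)
  have S: "of_nat (Suc k) = (of_nat k + 1 :: complex fps)" by simp
  define x where "x = (of_nat k :: complex fps)"
  note rec = extremal_series_rec[of k, folded x_def]
  \<comment> \<open>Inserting the recursion for the last summand turns this into k + 2 times the
    second identity for k.\<close>
  show "?up (Suc k)"
  proof -
    have e: "(x + 1 + 1) * (6 * (x + 1) - 1) * E6_series * extremal_series (Suc k)
       + 144 * (6 * (x + 1) - 1) * (6 * (x + 1) + 7) * extremal_series (Suc (Suc k)) =
      (x + 2) * (6 * x + 5) * E6_series * extremal_series (Suc k) + 12 * (12 * (6 * x + 5) * (6 * x + 13) * extremal_series (Suc (Suc k)))"
      by (simp add: algebra_simps)
    have f: "12 * q_deriv (extremal_series (Suc k)) - (6 * (x + 1) + 1) * E2_series * extremal_series (Suc k)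
      = 12 * q_deriv (extremal_series (Suc k)) - (6 * x + 7) * E2_series * extremal_series (Suc k)"
      by (simp add: algebra_simps)
    show ?thesis
      unfolding S x_def[symmetric] e f Suc.IH(2)[folded x_def] rec by (simp add: algebra_simps)
  qed
  have "E4_series * (12 * q_deriv (extremal_series (Suc (Suc k))) - (6 * x + 13) * E2_series * extremal_series (Suc (Suc k)))
    = - (6 * x + 13) * E6_series * extremal_series (Suc (Suc k)) + 12 * (x + 2) * Delta_series * extremal_series (Suc k)"
    by (rule ladder_step[OF Delta_series_eq q_deriv_E6 q_deriv_Delta rec extremal_series_q_deriv_rec[of k, folded x_def]
      Suc.IH[folded x_def] of_nat_linear_neq_0[of k, folded x_def]])
  thus "?down (Suc k)" unfolding S x_def[symmetric] by (simp add: algebra_simps)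
qed

section \<open>Leading coefficients of the extremal series\<close>

lemma fps_mult_nth_vanishing:
  fixes F G :: "'a :: comm_ring_1 fps"
  assumes F: "\<forall>j<n. fps_nth F j = 0"
  shows "j < n \<Longrightarrow> fps_nth (G * F) j = 0"
    and "fps_nth (G * F) n = fps_nth G 0 * fps_nth F n"
    and "fps_nth (G * F) (Suc n) = fps_nth G 0 * fps_nth F (Suc n) + fps_nth G 1 * fps_nth F n"
    and "fps_nth (G * F) (Suc (Suc n)) =
      fps_nth G 0 * fps_nth F (Suc (Suc n)) + fps_nth G 1 * fps_nth F (Suc n) + fps_nth G 2 * fps_nth F n"
proof -
  show "j < n \<Longrightarrow> fps_nth (G * F) j = 0"
    unfolding fps_mult_nth by (intro sum.neutral) (auto simp: F)
  have *: "fps_nth (G * F) (n + m) = (\<Sum>i=0..m. fps_nth G i * fps_nth F (n + m - i))" for m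
    unfolding fps_mult_nth by (rule sum.mono_neutral_right) (auto simp: F)
  show "fps_nth (G * F) n = fps_nth G 0 * fps_nth F n" using *[of 0] by simp
  show "fps_nth (G * F) (Suc n) = fps_nth G 0 * fps_nth F (Suc n) + fps_nth G 1 * fps_nth F n"
    using *[of 1] by simp
  show "fps_nth (G * F) (Suc (Suc n)) =
      fps_nth G 0 * fps_nth F (Suc (Suc n)) + fps_nth G 1 * fps_nth F (Suc n) + fps_nth G 2 * fps_nth F n"
    using *[of 2] by (simp add: numeral_2_eq_2)
qed

lemma fps_mult_nth_leading:
  fixes F G :: "'a :: comm_ring_1 fps"
  assumes F: "\<And>j. j < m \<Longrightarrow> fps_nth F j = 0" and G: "\<And>j. j < n \<Longrightarrow> fps_nth G j = 0"
  shows "fps_nth (F * G) (m + n) = fps_nth F m * fps_nth G n"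
    and "j < m + n \<Longrightarrow> fps_nth (F * G) j = 0"
proof -
  have "fps_nth F i * fps_nth G (m + n - i) = 0" if "i \<in> {0..m + n} - {m}" for i
    using that F[of i] G[of "m + n - i"] by (cases "i < m") auto
  hence "fps_nth (F * G) (m + n) = (\<Sum>i\<in>{m}. fps_nth F i * fps_nth G (m + n - i))"
    unfolding fps_mult_nth by (intro sum.mono_neutral_right) auto
  thus "fps_nth (F * G) (m + n) = fps_nth F m * fps_nth G n" by simp
  assume "j < m + n"
  hence "fps_nth F i * fps_nth G (j - i) = 0" if "i \<in> {0..j}" for i
    using that F[of i] G[of "j - i"] by (cases "i < m") auto
  thus "fps_nth (F * G) j = 0" unfolding fps_mult_nth by (intro sum.neutral) auto
qed

text \<open>The second coefficients belong to the induction because the leading coefficient of the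
  next form is a multiple of their difference minus 480. The origin of the quadratic: u_k, which is
  k + 1 times the second coefficient, satisfies u_k = u_(k-1) + 96 k + 60 by the differential
  relation, and u_0 = -24.\<close>

lemma extremal_series_leading:
  "(\<forall>j<k. fps_nth (extremal_series k) j = 0) \<and> fps_nth (extremal_series k) k = 1 \<and>
   (of_nat k + 1) * fps_nth (extremal_series k) (Suc k) = 48 * of_nat k ^ 2 + 108 * of_nat k - 24"
proof (induction k rule: induct_nat_012)
  case 0
  show ?case using E2_series_nth by simp
next
  case 1
  have "fps_nth (extremal_series (Suc 0)) 0 = 0" "fps_nth (extremal_series (Suc 0)) 1 = 1" "fps_nth (extremal_series (Suc 0)) 2 = 66"
    unfolding extremal_series.simps fps_mult_left_const_nth fps_sub_nth
      fps_mult_nth_0 fps_mult_nth_1 fps_mult_nth_2' E2_series_nth E4_series_nth E6_series_nth by simp_all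
  thus ?case by (simp add: numeral_2_eq_2)
next
  case (ge2 k)
  let ?f = "extremal_series k" and ?g = "extremal_series (Suc k)" and ?h = "extremal_series (Suc (Suc k))"
  define x where "x = (of_nat k :: complex)"
  have x: "x + 1 \<noteq> 0" "x + 2 \<noteq> 0" "x + 3 \<noteq> 0" "6 * x + 5 \<noteq> 0" "6 * x + 13 \<noteq> 0"
  proof -
    have "x + 1 = of_nat (k + 1)" "x + 2 = of_nat (k + 2)" "x + 3 = of_nat (k + 3)"
      "6 * x + 5 = of_nat (6 * k + 5)" "6 * x + 13 = of_nat (6 * k + 13)" by (simp_all add: x_def)
    thus "x + 1 \<noteq> 0" "x + 2 \<noteq> 0" "x + 3 \<noteq> 0" "6 * x + 5 \<noteq> 0" "6 * x + 13 \<noteq> 0"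
      by (simp_all only: of_nat_eq_0_iff)
  qed
  define N where "N = 12 * (6 * x + 5) * (6 * x + 13)"
  have N: "N \<noteq> 0" unfolding N_def mult_eq_0_iff using x by (simp only: simp_thms) simp
  define a b where "a = fps_nth ?f (Suc k)" and "b = fps_nth ?g (Suc (Suc k))"
  have f: "\<forall>j<k. fps_nth ?f j = 0" "fps_nth ?f k = 1"
    and a: "(x + 1) * a = 48 * x ^ 2 + 108 * x - 24"
    using ge2(1) by (simp_all add: a_def x_def)
  have g: "\<forall>j<Suc k. fps_nth ?g j = 0" "fps_nth ?g (Suc k) = 1"
    and b: "(x + 2) * b = 48 * (x + 1) ^ 2 + 108 * (x + 1) - 24"
    using ge2(2) by (auto simp: b_def x_def algebra_simps)
  note mf = fps_mult_nth_vanishing[OF f(1)] and mg = fps_mult_nth_vanishing[OF g(1)]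
  let ?T = "E6_series * ?g - Delta_series * ?f"
  have T0: "fps_nth ?T j = 0" if "j < Suc (Suc k)" for j
  proof -
    \<comment> \<open>At j = k + 1 the leading coefficients of the two products cancel.\<close>
    consider "j < k" | "j = k" | "j = Suc k" using \<open>j < Suc (Suc k)\<close> by linarith
    thus ?thesis
      by cases (simp_all add: mf mg f g Delta_series_nth[unfolded One_nat_def] Delta_series_nth E6_series_nth)
  qed
  have T1: "fps_nth ?T (Suc (Suc k)) = b - 504 - (a - 24)"
    unfolding fps_sub_nth mf(4) mg(3) f g Delta_series_nth E6_series_nth a_def b_def by simp
  have d: "of_nat (12 * (6 * k + 5) * (6 * k + 13)) = 12 * (6 * x + 5) * (6 * x + 13)"
    "of_nat (Suc k * Suc (Suc k)) = (x + 1) * (x + 2)" by (simp_all add: x_def algebra_simps)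
  have "12 * (6 * x + 5) * (6 * x + 13) + (x + 1) * (x + 2) * (b - a - 480) = 0"
  proof -
    have "(x + 1) * (x + 2) * (b - a - 480) = (x + 1) * ((x + 2) * b) - (x + 2) * ((x + 1) * a) - 480 * (x + 1) * (x + 2)"
      by (simp add: algebra_simps)
    thus ?thesis unfolding a b by (simp add: algebra_simps power2_eq_square)
  qed
  hence eq: "(x + 1) * (x + 2) * (b - 504 - (a - 24)) = - N"
    unfolding N_def by (simp add: algebra_simps)
  have "fps_nth ?h (Suc (Suc k)) = - ((x + 1) * (x + 2) * (b - 504 - (a - 24))) / N"
    unfolding extremal_series.simps fps_mult_left_const_nth T1 d N_def[symmetric]
    by (simp only: minus_divide_left times_divide_eq_left mult_minus_left)
  also have "\<dots> = 1" unfolding eq using N by simp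
  finally have h1: "fps_nth ?h (Suc (Suc k)) = 1" .
  have h0: "\<forall>j<Suc (Suc k). fps_nth ?h j = 0"
    unfolding extremal_series.simps fps_mult_left_const_nth by (simp add: T0 del: fps_sub_nth)
  define c where "c = fps_nth ?h (Suc (Suc (Suc k)))"
  note mh = fps_mult_nth_vanishing[OF h0]
  \<comment> \<open>The second identity of \<open>extremal_series_ladder\<close> is compared at
    q^(k+3), one degree above the start of \<open>?Y\<close>; the multiples (6k + 13) c cancel and
    12 (k + 3) c remains.\<close>
  let ?Y = "12 * q_deriv ?h - fps_const (6 * x + 13) * (E2_series * ?h)"
  have Y0: "\<forall>j<Suc (Suc k). fps_nth ?Y j = 0"
    using h0 by (simp add: mh(1))
  have Y: "fps_nth ?Y (Suc (Suc k)) = 12 * (x + 2) - (6 * x + 13)"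
    "fps_nth ?Y (Suc (Suc (Suc k))) = 12 * (x + 3) * c - (6 * x + 13) * (c - 24)"
    unfolding fps_sub_nth fps_mult_left_const_nth mh fps_mult_numeral_left q_deriv_nth h1 E2_series_nth c_def
    by (simp_all add: x_def algebra_simps)
  have "E4_series * ?Y = fps_const (- (6 * x + 13)) * (E6_series * ?h) + fps_const (12 * (x + 2)) * (Delta_series * ?g)"
  proof -
    have "6 * x + 13 = of_nat (6 * k + 13)" "12 * (x + 2) = of_nat (12 * (k + 2))" by (simp_all add: x_def)
    hence "fps_const (6 * x + 13) = 6 * of_nat (Suc k) + 7" "fps_const (12 * (x + 2)) = 12 * (of_nat (Suc k) + 1)"
      by (simp_all only: fps_of_nat) simp_all
    thus ?thesis
      using extremal_series_ladder(2)[of "Suc k"] unfolding fps_const_neg[symmetric] by (simp only: mult.assoc)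
  qed
  hence "fps_nth (E4_series * ?Y) (Suc (Suc (Suc k))) =
      fps_nth (fps_const (- (6 * x + 13)) * (E6_series * ?h) + fps_const (12 * (x + 2)) * (Delta_series * ?g)) (Suc (Suc (Suc k)))"
    by (rule arg_cong)
  hence "(12 * (x + 3) * c - (6 * x + 13) * (c - 24)) + 240 * (12 * (x + 2) - (6 * x + 13)) =
     - (6 * x + 13) * (c - 504) + 12 * (x + 2) * (b - 24)"
    unfolding fps_mult_nth_vanishing[OF Y0] Y fps_add_nth fps_mult_left_const_nth mh mg g h1
      E4_series_nth E6_series_nth Delta_series_nth c_def b_def by simp
  hence "12 * ((x + 3) * c) = 12 * ((x + 2) * b + 96 * (x + 2) + 60)" by (simp add: algebra_simps)
  hence "(x + 3) * c = (x + 2) * b + 96 * (x + 2) + 60" by (subst (asm) mult_cancel_left) simp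
  hence "(x + 3) * c = 48 * (x + 2) ^ 2 + 108 * (x + 2) - 24"
    unfolding b by (simp add: algebra_simps power2_eq_square)
  moreover have "of_nat (Suc (Suc k)) = x + 2" "x + 2 + 1 = x + 3" by (simp_all add: x_def)
  ultimately show ?case using h0 h1 by (simp only: c_def simp_thms)
qed

section \<open>Quasimodular series of depth at most 1\<close>

definition quasimodular_series :: "nat \<Rightarrow> complex fps set" where
  "quasimodular_series w = {F0 + F1 * E2_series | F0 F1. F0 \<in> modular_series w \<and> F1 \<in> modular_series (w - 2)}"

lemma quasimodular_seriesI:
  "F0 \<in> modular_series w \<Longrightarrow> F1 \<in> modular_series (w - 2) \<Longrightarrow> F = F0 + F1 * E2_series \<Longrightarrow> F \<in> quasimodular_series w"
  by (auto simp: quasimodular_series_def)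

lemma quasimodular_series_diff:
  assumes "F \<in> quasimodular_series w" "G \<in> quasimodular_series w"
  shows "F - G \<in> quasimodular_series w"
proof -
  from assms obtain F0 F1 G0 G1 where "F = F0 + F1 * E2_series" "G = G0 + G1 * E2_series"
    "F0 \<in> modular_series w" "G0 \<in> modular_series w" "F1 \<in> modular_series (w - 2)" "G1 \<in> modular_series (w - 2)"
    by (auto simp: quasimodular_series_def)
  thus ?thesis
    by (intro quasimodular_seriesI[of "F0 - G0" _ "F1 - G1"] modular_series_diff) (simp_all add: algebra_simps)
qed

text \<open>The assumption w \<ge> 2 keeps the truncated weight \<open>w - 2\<close> additive in
  v.\<close>

lemma quasimodular_series_mult:
  assumes "F \<in> modular_series v" "G \<in> quasimodular_series w" "w \<ge> 2"
  shows "F * G \<in> quasimodular_series (v + w)"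
proof -
  from assms obtain G0 G1 where "G = G0 + G1 * E2_series"
    "G0 \<in> modular_series w" "G1 \<in> modular_series (w - 2)"
    by (auto simp: quasimodular_series_def)
  moreover have "v + w - 2 = v + (w - 2)" using assms by simp
  ultimately show ?thesis using assms
    by (intro quasimodular_seriesI[of "F * G0" _ "F * G1"] modular_series_mult') (auto simp: algebra_simps)
qed

lemma quasimodular_series_cmult:
  assumes "G \<in> quasimodular_series w" "w \<ge> 2"
  shows "fps_const c * G \<in> quasimodular_series w"
  using quasimodular_series_mult[OF modular_series_const assms] by simp

lemma extremal_series_quasimodular: "extremal_series k \<in> quasimodular_series (6 * k + 2)"
proof (induction k rule: induct_nat_012)
  case 0
  have "0 \<in> modular_series w" for w by (auto intro!: modular_seriesI)
  moreover have "fps_const 1 \<in> modular_series 0" by (rule modular_series_const)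
  ultimately show ?case by (intro quasimodular_seriesI[of 0 _ "fps_const 1"]) simp_all
next
  case 1
  have "E4_series * E4_series \<in> modular_series (4 + 4)"
    by (intro modular_series_mult E4_series_modular)
  thus ?case
    by (intro quasimodular_seriesI[of "fps_const (1/1008) * (E4_series * E4_series)" _ "fps_const (- 1 / 1008) * E6_series"]
      modular_series_cmult) (simp_all add: E6_series_modular algebra_simps flip: fps_const_neg)
next
  case (ge2 k)
  have "E6_series * extremal_series (Suc k) \<in> quasimodular_series (6 + (6 * Suc k + 2))"
    "Delta_series * extremal_series k \<in> quasimodular_series (12 + (6 * k + 2))"
    by (intro quasimodular_series_mult E6_series_modular Delta_series_modular ge2; simp)+
  thus ?case unfolding extremal_series.simps
    by (intro quasimodular_series_cmult quasimodular_series_diff) (simp_all add: algebra_simps)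
qed

text \<open>
  With \<open>D = q d/dq\<close>, the form \<open>W = F\<^sup>2 + 12 (F DF\<^sub>1 - F\<^sub>1 DF)\<close> is modular of weight \<open>12k + 4\<close> (it is the Wronskian of \<open>F\<close> and
  \<open>z F + 12 F\<^sub>1 / (2 \<pi> i)\<close> up to a constant), so it vanishes; comparing leading coefficients then
  shows that \<open>F\<close> and \<open>F\<^sub>1\<close> have the same order at the cusp.
\<close>

theorem quasimodular_series_eq_0:
  assumes F: "F \<in> quasimodular_series (6 * k + 2)" and van: "\<And>n. n \<le> k \<Longrightarrow> fps_nth F n = 0"
  shows "F = 0"
proof (rule ccontr)
  assume nz: "F \<noteq> 0"
  obtain F0 F1 where F_eq: "F = F0 + F1 * E2_series" and
    F0: "F0 \<in> modular_series (6 * k + 2)" and F1: "F1 \<in> modular_series (6 * k)"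
    using F by (auto simp: quasimodular_series_def)
  have F1_nz: "F1 \<noteq> 0"
  proof
    assume "F1 = 0"
    hence "F = F0" by (simp add: F_eq)
    hence "F = 0" using F0 van by (intro modular_series_eq_0[of _ "6 * k + 2" "Suc k"]) simp_all
    with nz show False by contradiction
  qed
  define s where "s = subdegree F1"
  have s: "s \<le> k"
  proof (rule ccontr)
    assume "\<not> s \<le> k"
    hence "F1 = 0" using F1 by (intro modular_series_eq_0[of _ "6 * k" s]) (auto simp: s_def)
    with F1_nz show False by contradiction
  qed
  define r where "r = subdegree F"
  have r: "r > k" using nz van by (metis r_def nth_subdegree_nonzero not_le)
  have F_low: "fps_nth F j = 0" if "j < r" for j using that unfolding r_def by (rule nth_less_subdegree_zero)
  have F1_low: "fps_nth F1 j = 0" if "j < s" for j using that unfolding s_def by (rule nth_less_subdegree_zero)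
  \<comment> \<open>The weights of F0 and F1 differ by 2, so the E_2 parts of the Serre derivatives
    leave exactly the cross term 2 E_2 F0 F1 of F^2. The summand with E_4 is what remains of E_2^2
    F1^2 after subtracting 12 F1^2 D E_2.\<close>
  let ?W = "F0 * F0 + E4_series * (F1 * F1) + fps_const 12 * (F0 * serre_deriv (6 * k) F1 - F1 * serre_deriv (6 * k + 2) F0)"
  have "?W \<in> modular_series (12 * k + 4)"
  proof (intro modular_series_add modular_series_cmult modular_series_diff)
    show "F0 * F0 \<in> modular_series (12 * k + 4)"
      by (rule modular_series_mult'[OF F0 F0]) simp
    show "E4_series * (F1 * F1) \<in> modular_series (12 * k + 4)"
      by (rule modular_series_mult'[OF E4_series_modular modular_series_mult[OF F1 F1]]) simp
    show "F0 * serre_deriv (6 * k) F1 \<in> modular_series (12 * k + 4)"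
      by (rule modular_series_mult'[OF F0 serre_deriv_modular[OF F1]]) simp
    show "F1 * serre_deriv (6 * k + 2) F0 \<in> modular_series (12 * k + 4)"
      by (rule modular_series_mult'[OF F1 serre_deriv_modular[OF F0]]) simp
  qed
  moreover have W: "?W = F * F + 12 * (q_deriv F1 * F - F1 * q_deriv F)"
  proof -
    have "serre_deriv (6 * k) F1 = q_deriv F1 - fps_const (of_nat k / 2) * E2_series * F1"
      "serre_deriv (6 * k + 2) F0 = q_deriv F0 - fps_const (of_nat k / 2 + 1 / 6) * E2_series * F0"
      by (simp_all add: serre_deriv_def add_divide_distrib)
    moreover define a c :: "complex fps" where "a = fps_const (of_nat k / 2)" and "c = fps_const (1 / 6)"
    moreover have "12 * c = 2" unfolding c_def numeral_fps_const fps_const_mult by simp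
    moreover have "fps_const 12 * (F0 * (q_deriv F1 - a * E2_series * F1) - F1 * (q_deriv F0 - (a + c) * E2_series * F0))
      = 12 * (F0 * q_deriv F1 - F1 * q_deriv F0) + (12 * c) * E2_series * F0 * F1"
      unfolding numeral_fps_const' by (simp add: algebra_simps)
    ultimately have "?W = F0 * F0 + E4_series * (F1 * F1) + (12 * (F0 * q_deriv F1 - F1 * q_deriv F0) + 2 * E2_series * F0 * F1)"
      by (simp only: fps_const_add[symmetric])
    also have "\<dots> = F * F + 12 * (q_deriv F1 * F0 - F1 * q_deriv F0) - F1 * F1 * (12 * q_deriv E2_series)"
      unfolding q_deriv_E2 F_eq by (simp add: algebra_simps)
    also have "\<dots> = F * F + 12 * (q_deriv F1 * F - F1 * q_deriv F)"
      unfolding F_eq q_deriv_add q_deriv_mult by (simp add: algebra_simps)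
    finally show ?thesis .
  qed
  moreover have "fps_nth ?W n = 0" if "n < Suc k" for n
  proof -
    have F': "\<forall>j<Suc k. fps_nth F j = 0" "\<forall>j<Suc k. fps_nth (q_deriv F) j = 0"
      using van by auto
    show ?thesis unfolding W using fps_mult_nth_vanishing(1)[OF F'(1) that] fps_mult_nth_vanishing(1)[OF F'(2) that]
      by (simp add: fps_mult_numeral_left)
  qed
  ultimately have "?W = 0"
    by (intro modular_series_eq_0[of ?W "12 * k + 4" "Suc k"]) auto
  \<comment> \<open>At degree r + s the square drops out because s \<le> k < r; the other two
    products contribute s and r times the same nonzero number.\<close>
  hence "fps_nth (F * F) (r + s) + 12 * (fps_nth (q_deriv F1 * F) (r + s) - fps_nth (F1 * q_deriv F) (r + s)) = 0"
    using W by (metis fps_add_nth fps_sub_nth fps_mult_numeral_left fps_zero_nth)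
  moreover have "fps_nth (F * F) (r + s) = 0"
    by (rule fps_mult_nth_leading(2)[of r F r F]) (use r s F_low in auto)
  moreover have "fps_nth (q_deriv F1 * F) (s + r) = fps_nth (q_deriv F1) s * fps_nth F r"
    by (rule fps_mult_nth_leading(1)) (use F_low F1_low in auto)
  moreover have "fps_nth (F1 * q_deriv F) (s + r) = fps_nth F1 s * fps_nth (q_deriv F) r"
    by (rule fps_mult_nth_leading(1)) (use F_low F1_low in auto)
  ultimately have "(of_nat s - of_nat r) * (fps_nth F1 s * fps_nth F r) = 0"
    by (simp add: algebra_simps)
  moreover have "fps_nth F r \<noteq> 0" "fps_nth F1 s \<noteq> 0" using nz F1_nz by (simp_all add: r_def s_def)
  ultimately show False using r s by auto
qed

section \<open>The dimension of the space of quasimodular forms\<close>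

definition upper_fun :: "complex fps \<Rightarrow> complex \<Rightarrow> complex" where
  "upper_fun F z = (if z \<in> upper_half_plane then q_eval F z else 0)"

lemma q_series_quasimodular: "F \<in> quasimodular_series w \<Longrightarrow> q_series F"
  unfolding quasimodular_series_def
  by (auto intro!: q_series_add q_series_mult q_series_E2 dest: modular_seriesD(1))

lemma upper_fun_add: "q_series F \<Longrightarrow> q_series G \<Longrightarrow> upper_fun (F + G) = upper_fun F + upper_fun G"
  by (auto simp: fun_eq_iff upper_fun_def q_eval_add upper_half_plane_def)

lemma upper_fun_cmult: "q_series F \<Longrightarrow> upper_fun (fps_const c * F) = (\<lambda>z. c * upper_fun F z)"
  by (auto simp: fun_eq_iff upper_fun_def q_eval_mult upper_half_plane_def)

lemma upper_fun_0: "upper_fun 0 = 0"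
  by (auto simp: fun_eq_iff upper_fun_def)

lemma upper_fun_inj: "q_series F \<Longrightarrow> q_series G \<Longrightarrow> upper_fun F = upper_fun G \<Longrightarrow> F = G"
  by (rule q_eval_inj) (auto simp: fun_eq_iff upper_fun_def upper_half_plane_def split: if_splits)

section \<open>From the inversion to the full modular group\<close>

lemma Im_moebius:
  fixes a b c d :: int
  assumes "a * d - b * c = 1" "Im z > 0"
  shows "Im ((of_int a * z + of_int b) / (of_int c * z + of_int d)) > 0"
proof -
  define N where "N = of_int a * z + of_int b"
  define M where "M = of_int c * z + of_int d"
  have "c \<noteq> 0 \<or> d \<noteq> 0" using assms(1) by auto
  hence M0: "M \<noteq> 0" using assms(2) by (auto simp: M_def complex_eq_iff)
  have "Im (N / M) = (Im N * Re M - Re N * Im M) / (cmod M)\<^sup>2" by (simp add: Im_divide cmod_power2)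
  also have "Im N * Re M - Re N * Im M = of_int (a * d - b * c) * Im z"
    by (simp add: N_def M_def algebra_simps)
  finally have "Im (N / M) = Im z / (cmod M)\<^sup>2" unfolding assms(1) by simp
  thus ?thesis using assms(2) M0 by (simp add: N_def M_def)
qed

text \<open>Euclid's algorithm on the first column: subtracting \<open>a div c\<close> times the
  lower row and inverting replaces the lower left entry c by a mod c. Two inversions give the matrix
  -1, whence a sign (-1)^w, which \<open>sgn\<close> absorbs.\<close>

lemma modular_transformation:
  fixes a b c d :: int and f :: "complex \<Rightarrow> complex"
  assumes T: "\<And>z n. Im z > 0 \<Longrightarrow> f (z + of_int n) = f z"
    and S: "\<And>z. Im z > 0 \<Longrightarrow> f (- 1 / z) = z ^ w * f z"
    and det: "a * d - b * c = 1" and z: "Im z > 0"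
  shows "f ((of_int a * z + of_int b) / (of_int c * z + of_int d)) = (of_int c * z + of_int d) ^ w * f z"
  using det
proof (induction "nat \<bar>c\<bar>" arbitrary: a b c d rule: less_induct)
  case less
  have sgn: "(-1) ^ w * f u = f u" if "Im u > 0" for u
  proof -
    have u: "u \<noteq> 0" "Im (- 1 / u) > 0" using that Im_minus_inverse_pos by auto
    have "f u = f (- 1 / (- 1 / u))" using u by simp
    also have "\<dots> = (- 1 / u) ^ w * (u ^ w * f u)" unfolding S[OF u(2)] S[OF that] ..
    also have "\<dots> = (- 1 / u * u) ^ w * f u" by (simp only: power_mult_distrib mult.assoc)
    also have "- 1 / u * u = - 1" using u by simp
    finally show ?thesis by (rule sym)
  qed
  show ?case
  proof (cases "c = 0")
    case True
    hence "a * d = 1" using less.prems by simp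
    hence "(a = 1 \<and> d = 1) \<or> (a = -1 \<and> d = -1)" by (simp add: zmult_eq_1_iff)
    thus ?thesis
    proof
      assume "a = 1 \<and> d = 1"
      thus ?thesis using True T[OF z, of b] by simp
    next
      assume "a = -1 \<and> d = -1"
      thus ?thesis using True T[OF z, of "-b"] sgn[OF z] by simp
    qed
  next
    case False
    define n where "n = a div c"
    define a' b' where "a' = a - n * c" and "b' = b - n * d"
    have a': "a' = a mod c" by (simp add: a'_def n_def minus_div_mult_eq_mod)
    have lt: "nat \<bar>a'\<bar> < nat \<bar>c\<bar>" using False abs_mod_less[of c a] by (simp add: a')
    have det': "a' * d - b' * c = 1" using less.prems by (simp add: a'_def b'_def algebra_simps)
    have det'': "(- c) * b' - (- d) * a' = 1" using det' by (simp add: algebra_simps)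
    define N where "N = of_int a' * z + of_int b'"
    define M where "M = of_int c * z + of_int d"
    have M0: "M \<noteq> 0" using False z by (auto simp: M_def complex_eq_iff)
    have ImNM: "Im (N / M) > 0" unfolding N_def M_def by (rule Im_moebius[OF det' z])
    hence N0: "N \<noteq> 0" by auto
    have "(of_int a * z + of_int b) / M = N / M + of_int n"
      using M0 by (simp add: field_simps N_def M_def a'_def b'_def)
    hence "f ((of_int a * z + of_int b) / M) = f (N / M)" using T[OF ImNM] by simp
    also have "\<dots> = f (- 1 / (- 1 / (N / M)))" using N0 M0 by simp
    also have "\<dots> = (- 1 / (N / M)) ^ w * f (- 1 / (N / M))"
      by (rule S[OF Im_minus_inverse_pos[OF ImNM]])
    also have "- 1 / (N / M) = (of_int (- c) * z + of_int (- d)) / (of_int a' * z + of_int b')"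
      using N0 M0 by (simp add: N_def M_def)
    also have "f \<dots> = N ^ w * f z"
      unfolding N_def by (rule less.hyps[OF lt det''])
    also have "((of_int (- c) * z + of_int (- d)) / (of_int a' * z + of_int b')) ^ w * (N ^ w * f z)
       = ((of_int (- c) * z + of_int (- d)) / N * N) ^ w * f z"
      unfolding N_def[symmetric] by (simp only: power_mult_distrib mult.assoc)
    also have "(of_int (- c) * z + of_int (- d)) / N * N = (-1) * M" using N0 by (simp add: M_def)
    also have "((-1) * M) ^ w * f z = M ^ w * ((-1) ^ w * f z)" by (simp only: power_mult_distrib mult_ac)
    finally show ?thesis unfolding sgn[OF z] M_def .
  qed
qed

lemma modular_forms_eq: "modular_forms (int w) = upper_fun ` modular_series w"
proof (intro equalityI subsetI)
  fix f assume f: "f \<in> modular_forms (int w)"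
  then obtain a where a: "has_q_expansion f a" by (auto simp: modular_forms_def)
  define F where "F = Abs_fps a"
  have F: "q_series F" "\<And>z. z \<in> upper_half_plane \<Longrightarrow> f z = q_eval F z"
    using a by (auto simp: has_q_expansion_iff F_def)
  have "f = upper_fun F" using f F(2) by (auto simp: fun_eq_iff upper_fun_def modular_forms_def)
  moreover have "F \<in> modular_series w"
  proof (rule modular_seriesI[OF F(1)])
    fix z assume z: "Im z > 0"
    have all: "\<forall>a b c d :: int. a * d - b * c = 1 \<longrightarrow>
            (\<forall>z\<in>upper_half_plane.
               f ((of_int a * z + of_int b) / (of_int c * z + of_int d))
                 = (of_int c * z + of_int d) powi (int w) * f z)"
      using f unfolding modular_forms_def by blast
    \<comment> \<open>The variables are instantiated in the order a, d, b, c of their occurrence in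
      the determinant; the matrix is that of the inversion.\<close>
    from all[rule_format, of 0 0 "-1" 1 z] z have "f (- 1 / z) = z ^ w * f z"
      by (simp add: upper_half_plane_def)
    thus "q_eval F (- 1 / z) = z ^ w * q_eval F z"
      using F(2)[of z] F(2)[of "- 1 / z"] z Im_minus_inverse_pos[OF z] by (simp add: upper_half_plane_def)
  qed
  ultimately show "f \<in> upper_fun ` modular_series w" by blast
next
  fix f assume "f \<in> upper_fun ` modular_series w"
  then obtain F where F: "F \<in> modular_series w" and f: "f = upper_fun F" by blast
  note q = modular_seriesD(1)[OF F]
  have uh: "upper_half_plane = {z. Im z > 0}" by (simp add: upper_half_plane_def)
  have "upper_fun F holomorphic_on upper_half_plane \<longleftrightarrow> q_eval F holomorphic_on upper_half_plane"
    by (rule holomorphic_cong) (auto simp: upper_fun_def)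
  hence "f holomorphic_on upper_half_plane" using holomorphic_q_eval[OF q] by (simp add: f uh)
  moreover have "has_q_expansion f (fps_nth F)"
    using q by (auto simp: has_q_expansion_iff f upper_fun_def fps_nth_inverse)
  moreover have "f ((of_int a * z + of_int b) / (of_int c * z + of_int d)) = (of_int c * z + of_int d) powi (int w) * f z"
    if "a * d - b * c = 1" "z \<in> upper_half_plane" for a b c d :: int and z
    using modular_transformation[of "q_eval F" w a d b c z, OF _ modular_seriesD(2)[OF F] that(1)]
      Im_moebius[OF that(1), of z] that(2) by (simp add: f upper_fun_def uh q_eval_add_int)
  ultimately show "f \<in> modular_forms (int w)"
    unfolding modular_forms_def by (auto simp: f upper_fun_def)
qed

lemma quasimodular_forms_eq:
  "quasimodular_forms_depth_le_1 (6 * int k + 2) = upper_fun ` quasimodular_series (6 * k + 2)"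
proof -
  have w: "6 * int k + 2 = int (6 * k + 2)" "int (6 * k + 2) - 2 = int (6 * k)" by simp_all
  have eq: "(\<lambda>z. upper_fun F0 z + upper_fun F1 z * Eisenstein_E2 z) = upper_fun (F0 + F1 * E2_series)"
    if "F0 \<in> modular_series (6 * k + 2)" "F1 \<in> modular_series (6 * k)" for F0 F1
    using that[THEN modular_seriesD(1)] q_series_E2
    by (auto simp: fun_eq_iff upper_fun_def upper_half_plane_def q_eval_add q_eval_mult q_series_mult q_eval_E2)
  show ?thesis
  proof (intro equalityI subsetI)
    fix f assume "f \<in> quasimodular_forms_depth_le_1 (6 * int k + 2)"
    then obtain F0 F1 where "F0 \<in> modular_series (6 * k + 2)" "F1 \<in> modular_series (6 * k)"
      "f = (\<lambda>z. upper_fun F0 z + upper_fun F1 z * Eisenstein_E2 z)"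
      unfolding quasimodular_forms_depth_le_1_def w modular_forms_eq by blast
    thus "f \<in> upper_fun ` quasimodular_series (6 * k + 2)"
      using eq[of F0 F1] unfolding quasimodular_series_def by auto
  next
    fix f assume "f \<in> upper_fun ` quasimodular_series (6 * k + 2)"
    then obtain F0 F1 where F: "F0 \<in> modular_series (6 * k + 2)" "F1 \<in> modular_series (6 * k)"
      "f = upper_fun (F0 + F1 * E2_series)"
      unfolding quasimodular_series_def by auto
    hence "f = (\<lambda>z. upper_fun F0 z + upper_fun F1 z * Eisenstein_E2 z)" by (simp only: eq)
    with F(1,2) show "f \<in> quasimodular_forms_depth_le_1 (6 * int k + 2)"
      unfolding quasimodular_forms_depth_le_1_def w modular_forms_eq by blast
  qed
qed

section \<open>A triangular basis\<close>

definition quasimodular_basis :: "nat \<Rightarrow> nat \<Rightarrow> complex fps" where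
  "quasimodular_basis k j = E6_series ^ (k - j) * extremal_series j"

lemma quasimodular_basis_in:
  assumes "j \<le> k"
  shows "quasimodular_basis k j \<in> quasimodular_series (6 * k + 2)"
proof -
  have "E6_series ^ (k - j) * extremal_series j \<in> quasimodular_series ((k - j) * 6 + (6 * j + 2))"
    by (intro quasimodular_series_mult modular_series_power E6_series_modular extremal_series_quasimodular) simp
  also have "(k - j) * 6 + (6 * j + 2) = 6 * k + 2" using assms by simp
  finally show ?thesis by (simp add: quasimodular_basis_def)
qed

lemma quasimodular_basis_nth:
  shows "n < j \<Longrightarrow> fps_nth (quasimodular_basis k j) n = 0" "fps_nth (quasimodular_basis k j) j = 1"
proof -
  have f: "\<forall>n<j. fps_nth (extremal_series j) n = 0" "fps_nth (extremal_series j) j = 1"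
    using extremal_series_leading[of j] by auto
  show "n < j \<Longrightarrow> fps_nth (quasimodular_basis k j) n = 0"
    unfolding quasimodular_basis_def by (rule fps_mult_nth_vanishing(1)[OF f(1)])
  show "fps_nth (quasimodular_basis k j) j = 1"
    unfolding quasimodular_basis_def fps_mult_nth_vanishing(2)[OF f(1)] f(2)
    by (simp add: fps_power_zeroth E6_series_nth)
qed

text \<open>Elimination from the lowest degree upwards: the basis form with leading term q^m removes
  the coefficient of q^m, and d counts the degrees that remain. The base case is
  \<open>quasimodular_series_eq_0\<close>.\<close>

lemma quasimodular_basis_spans:
  assumes "F \<in> quasimodular_series (6 * k + 2)" "\<forall>n<Suc k - d. fps_nth F n = 0"
  shows "upper_fun F \<in> complex_fun.span ((\<lambda>j. upper_fun (quasimodular_basis k j)) ` {..k})"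
  using assms
proof (induction d arbitrary: F)
  case 0
  hence "F = 0" by (intro quasimodular_series_eq_0[of F k]) auto
  show ?case unfolding \<open>F = 0\<close> upper_fun_0 by (rule complex_fun.span_zero)
next
  case (Suc d)
  show ?case
  proof (cases "d \<le> k")
    case False
    \<comment> \<open>For d > k both vanishing bounds are truncated to 0, so the induction
      hypothesis applies directly.\<close>
    thus ?thesis using Suc by simp
  next
    case True
    define m where "m = k - d"
    define B where "B = quasimodular_basis k m"
    define c where "c = fps_nth F m"
    have B: "B \<in> quasimodular_series (6 * k + 2)" unfolding B_def by (intro quasimodular_basis_in) (simp add: m_def)
    hence cB: "fps_const c * B \<in> quasimodular_series (6 * k + 2)" by (intro quasimodular_series_cmult) simp_all
    let ?G = "F - fps_const c * B"
    have G: "?G \<in> quasimodular_series (6 * k + 2)" by (intro quasimodular_series_diff cB Suc.prems)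
    have "fps_nth ?G n = 0" if "n < Suc k - d" for n
    proof (cases "n = m")
      case True
      thus ?thesis by (simp add: c_def B_def quasimodular_basis_nth)
    next
      case False
      hence "n < m" using that \<open>d \<le> k\<close> by (simp add: m_def)
      thus ?thesis using Suc.prems(2) by (simp add: B_def quasimodular_basis_nth m_def)
    qed
    hence "upper_fun ?G \<in> complex_fun.span ((\<lambda>j. upper_fun (quasimodular_basis k j)) ` {..k})"
      using G by (intro Suc.IH) auto
    moreover have "(\<lambda>z. c * upper_fun B z) \<in> complex_fun.span ((\<lambda>j. upper_fun (quasimodular_basis k j)) ` {..k})"
      unfolding B_def by (intro complex_fun.span_scale complex_fun.span_base) (auto simp: m_def)
    ultimately have "upper_fun ?G + (\<lambda>z. c * upper_fun B z) \<in> complex_fun.span ((\<lambda>j. upper_fun (quasimodular_basis k j)) ` {..k})"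
      by (rule complex_fun.span_add)
    also have "upper_fun ?G + (\<lambda>z. c * upper_fun B z) = upper_fun (?G + fps_const c * B)"
      using G B cB by (simp only: upper_fun_add upper_fun_cmult q_series_quasimodular)
    finally show ?thesis by simp
  qed
qed

text \<open>Separates a basis form from the span of those with higher index, all of which lie in
  such a subspace.\<close>

lemma subspace_vanishing:
  "complex_fun.subspace {upper_fun F |F. q_series F \<and> (\<forall>n<m. fps_nth F n = 0)}"
proof (rule complex_fun.subspaceI)
  show "0 \<in> {upper_fun F |F. q_series F \<and> (\<forall>n<m. fps_nth F n = 0)}"
    by (auto intro!: exI[of _ 0] simp: upper_fun_0)
next
  fix f g assume "f \<in> {upper_fun F |F. q_series F \<and> (\<forall>n<m. fps_nth F n = 0)}"
    "g \<in> {upper_fun F |F. q_series F \<and> (\<forall>n<m. fps_nth F n = 0)}"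
  then obtain F G where "f = upper_fun F" "g = upper_fun G" "q_series F" "q_series G"
    "\<forall>n<m. fps_nth F n = 0" "\<forall>n<m. fps_nth G n = 0" by blast
  thus "f + g \<in> {upper_fun F |F. q_series F \<and> (\<forall>n<m. fps_nth F n = 0)}"
    by (auto intro!: exI[of _ "F + G"] simp: upper_fun_add q_series_add)
next
  fix c f assume "f \<in> {upper_fun F |F. q_series F \<and> (\<forall>n<m. fps_nth F n = 0)}"
  then obtain F where "f = upper_fun F" "q_series F" "\<forall>n<m. fps_nth F n = 0" by blast
  thus "(\<lambda>z. c * f z) \<in> {upper_fun F |F. q_series F \<and> (\<forall>n<m. fps_nth F n = 0)}"
    by (auto intro!: exI[of _ "fps_const c * F"] simp: upper_fun_cmult q_series_mult)
qed

lemma quasimodular_basis_independent: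
  assumes "m \<le> Suc k"
  shows "complex_fun.independent ((\<lambda>j. upper_fun (quasimodular_basis k j)) ` {m..k}) \<and>
    card ((\<lambda>j. upper_fun (quasimodular_basis k j)) ` {m..k}) = Suc k - m"
  using assms
proof (induction m rule: inc_induct)
  case base
  show ?case by (simp add: complex_fun.independent_empty)
next
  case (step m)
  let ?g = "\<lambda>j. upper_fun (quasimodular_basis k j)"
  let ?V = "{upper_fun F |F. q_series F \<and> (\<forall>n<Suc m. fps_nth F n = 0)}"
  have q: "q_series (quasimodular_basis k j)" if "j \<le> k" for j
    by (rule q_series_quasimodular[OF quasimodular_basis_in[OF that]])
  have "?g ` {Suc m..k} \<subseteq> ?V"
  proof (rule image_subsetI)
    fix j assume "j \<in> {Suc m..k}"
    thus "?g j \<in> ?V" unfolding mem_Collect_eq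
      by (intro exI[of _ "quasimodular_basis k j"] conjI refl q allI impI quasimodular_basis_nth(1)) auto
  qed
  hence "complex_fun.span (?g ` {Suc m..k}) \<subseteq> ?V" by (rule complex_fun.span_minimal[OF _ subspace_vanishing])
  moreover have "?g m \<notin> ?V"
  proof
    assume "?g m \<in> ?V"
    then obtain F where F: "?g m = upper_fun F" "q_series F" "fps_nth F m = 0" by blast
    have "quasimodular_basis k m = F" using F(1) by (rule upper_fun_inj[rotated 2]) (use F q step in auto)
    thus False using F(3) quasimodular_basis_nth(2)[of k m] by simp
  qed
  ultimately have notin: "?g m \<notin> complex_fun.span (?g ` {Suc m..k})" by blast
  have notin': "?g m \<notin> ?g ` {Suc m..k}"
  proof
    assume "?g m \<in> ?g ` {Suc m..k}"
    from complex_fun.span_base[OF this] notin show False by contradiction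
  qed
  have "{m..k} = insert m {Suc m..k}" using step by auto
  hence ins: "?g ` {m..k} = insert (?g m) (?g ` {Suc m..k})" by simp
  show ?case unfolding ins using step.IH notin notin' step.hyps
    by (auto simp: complex_fun.independent_insert)
qed

lemma quasimodular_dim_eq: "quasimodular_dim (6 * int k + 2) = Suc k"
  unfolding quasimodular_dim_def
proof (rule complex_fun.dim_unique)
  let ?B = "(\<lambda>j. upper_fun (quasimodular_basis k j)) ` {..k}"
  show "?B \<subseteq> quasimodular_forms_depth_le_1 (6 * int k + 2)"
    unfolding quasimodular_forms_eq using quasimodular_basis_in by auto
  show "quasimodular_forms_depth_le_1 (6 * int k + 2) \<subseteq> complex_fun.span ?B"
    unfolding quasimodular_forms_eq using quasimodular_basis_spans[of _ k "Suc k"] by auto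
  show "complex_fun.independent ?B" "card ?B = Suc k"
    using quasimodular_basis_independent[of 0 k] by (simp_all add: atLeast0AtMost)
qed

section \<open>Integrality\<close>

definition localized_ints :: "nat \<Rightarrow> complex set" where
  "localized_ints N = of_rat ` ints_adjoin_prime_inverses N"

lemma localized_ints_of_int: "of_int i \<in> localized_ints N"
  unfolding localized_ints_def
  by (rule image_eqI[OF _ ints_adjoin_prime_inverses.of_int[of i]]) simp

lemma localized_ints_of_nat: "of_nat i \<in> localized_ints N"
  using localized_ints_of_int[of "int i"] by simp

lemma localized_ints_numeral: "numeral i \<in> localized_ints N"
  using localized_ints_of_nat[of "numeral i"] by simp

lemma localized_ints_add: "x \<in> localized_ints N \<Longrightarrow> y \<in> localized_ints N \<Longrightarrow> x + y \<in> localized_ints N"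
  unfolding localized_ints_def
  by (force simp: of_rat_add[symmetric] intro: ints_adjoin_prime_inverses.add)

lemma localized_ints_mult: "x \<in> localized_ints N \<Longrightarrow> y \<in> localized_ints N \<Longrightarrow> x * y \<in> localized_ints N"
  unfolding localized_ints_def
  by (force simp: of_rat_mult[symmetric] intro: ints_adjoin_prime_inverses.mult)

lemma localized_ints_minus: "x \<in> localized_ints N \<Longrightarrow> - x \<in> localized_ints N"
  using localized_ints_mult[OF localized_ints_of_int[of "-1"]] by simp

lemma localized_ints_diff: "x \<in> localized_ints N \<Longrightarrow> y \<in> localized_ints N \<Longrightarrow> x - y \<in> localized_ints N"
  using localized_ints_add[of x N "- y"] localized_ints_minus[of y N] by simp

lemma localized_ints_mono:
  assumes "N \<le> M"
  shows "localized_ints N \<subseteq> localized_ints M"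
proof -
  have "x \<in> ints_adjoin_prime_inverses M" if "x \<in> ints_adjoin_prime_inverses N" for x
    using that by induction (use assms in \<open>auto intro: ints_adjoin_prime_inverses.intros\<close>)
  thus ?thesis unfolding localized_ints_def by blast
qed

lemma localized_ints_inverse:
  assumes "0 < n" "n < N"
  shows "1 / of_nat n \<in> localized_ints N"
  using assms
proof (induction n rule: less_induct)
  case (less n)
  show ?case
  proof (cases "n = 1")
    case True
    thus ?thesis using localized_ints_of_int[of 1] by simp
  next
    case False
    then obtain p where p: "prime p" "p dvd n" using prime_factor_nat by blast
    then obtain m where m: "n = p * m" by blast
    have p1: "p > 1" using p prime_gt_1_nat by blast
    have "m > 0" "m < n" "p \<le> n" using less.prems p1 unfolding m by auto
    hence "1 / of_nat m \<in> localized_ints N" "p < N" using less by auto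
    moreover have "1 / of_nat p \<in> localized_ints N" unfolding localized_ints_def
      by (rule image_eqI[OF _ ints_adjoin_prime_inverses.inverse_prime[OF p(1) \<open>p < N\<close>]])
         (simp add: of_rat_divide inverse_eq_divide)
    ultimately have "1 / of_nat p * (1 / of_nat m) \<in> localized_ints N" by (intro localized_ints_mult)
    thus ?thesis by (simp add: m)
  qed
qed

definition fps_over :: "'a set \<Rightarrow> 'a :: comm_ring_1 fps \<Rightarrow> bool" where
  "fps_over S F \<longleftrightarrow> (\<forall>n. fps_nth F n \<in> S)"

lemma fps_over_diff: "fps_over (localized_ints N) F \<Longrightarrow> fps_over (localized_ints N) G \<Longrightarrow> fps_over (localized_ints N) (F - G)"
  by (simp add: fps_over_def localized_ints_diff)

lemma fps_over_mult:
  assumes "fps_over (localized_ints N) F" "fps_over (localized_ints N) G"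
  shows "fps_over (localized_ints N) (F * G)"
proof -
  have sum: "sum f A \<in> localized_ints N" if "\<And>x. x \<in> A \<Longrightarrow> f x \<in> localized_ints N" for f and A :: "nat set"
    using that localized_ints_of_nat[of 0 N]
    by (induction A rule: infinite_finite_induct) (auto intro: localized_ints_add)
  show ?thesis using assms unfolding fps_over_def fps_mult_nth
    by (intro allI sum localized_ints_mult) auto
qed

lemma fps_over_const: "c \<in> localized_ints N \<Longrightarrow> fps_over (localized_ints N) (fps_const c)"
  using localized_ints_of_nat[of 0 N] by (simp add: fps_over_def fps_nth_fps_const)

lemma fps_over_q_deriv: "fps_over (localized_ints N) F \<Longrightarrow> fps_over (localized_ints N) (q_deriv F)"
  by (simp add: fps_over_def localized_ints_mult localized_ints_of_nat)

lemma fps_over_power: "fps_over (localized_ints N) F \<Longrightarrow> fps_over (localized_ints N) (F ^ n)"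
  using fps_over_const[OF localized_ints_of_nat[of 1 N]]
  by (induction n) (auto intro: fps_over_mult)

lemma fps_over_E2: "fps_over (localized_ints N) E2_series"
proof -
  have "fps_nth E2_series n = of_int (if n = 0 then 1 else - 24 * int (divisor_power_sum 1 n))" for n
    by (simp add: E2_series_def)
  thus ?thesis unfolding fps_over_def using localized_ints_of_int by metis
qed

lemma fps_over_E4: "fps_over (localized_ints N) E4_series"
  unfolding E4_series_def
  by (intro fps_over_diff fps_over_mult fps_over_const fps_over_q_deriv fps_over_E2 localized_ints_numeral)

lemma fps_over_E6: "fps_over (localized_ints N) E6_series"
  unfolding E6_series_def
  by (intro fps_over_diff fps_over_mult fps_over_const fps_over_q_deriv fps_over_E2 fps_over_E4 localized_ints_numeral)

lemma fps_over_Delta: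
  assumes "N > 8"
  shows "fps_over (localized_ints N) Delta_series"
proof -
  \<comment> \<open>1728 = 6 * 6 * 6 * 8 with every factor below N.\<close>
  have "1 / of_nat 6 * (1 / of_nat 6 * (1 / of_nat 6 * (1 / of_nat 8))) \<in> localized_ints N"
    using assms by (intro localized_ints_mult localized_ints_inverse) auto
  hence "1 / 1728 \<in> localized_ints N" by simp
  thus ?thesis unfolding Delta_series_def
    by (intro fps_over_mult fps_over_const fps_over_diff fps_over_power fps_over_E4 fps_over_E6)
qed

lemma fps_over_extremal: "fps_over (localized_ints (6 * k + 2)) (extremal_series k)"
proof (induction k rule: induct_nat_012)
  case 0
  show ?case by (simp add: fps_over_E2)
next
  case 1
  \<comment> \<open>1008 = 6 * 6 * 4 * 7, and 7 is still below the weight 8.\<close>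
  have "1 / of_nat 6 * (1 / of_nat 6 * (1 / of_nat 4 * (1 / of_nat 7))) \<in> localized_ints 8"
    by (intro localized_ints_mult localized_ints_inverse) auto
  hence "1 / 1008 \<in> localized_ints 8" by simp
  hence "fps_over (localized_ints 8) (extremal_series (Suc 0))" unfolding extremal_series.simps
    by (intro fps_over_mult fps_over_const fps_over_diff fps_over_E2 fps_over_E4 fps_over_E6)
  thus ?case by simp
next
  case (ge2 k)
  let ?N = "6 * Suc (Suc k) + 2"
  have mono: "fps_over (localized_ints ?N) F" if "fps_over (localized_ints M) F" "M \<le> ?N" for M F
    using that localized_ints_mono[OF that(2)] by (auto simp: fps_over_def)
  \<comment> \<open>The factors 12, 6k + 5 and 6k + 13 are all below the weight 6k + 14, the last
    one by exactly 1.\<close>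
  have "- of_nat (Suc k * Suc (Suc k)) * (1 / of_nat 12 * (1 / of_nat (6 * k + 5) * (1 / of_nat (6 * k + 13))))
     \<in> localized_ints ?N"
    by (intro localized_ints_mult localized_ints_inverse localized_ints_minus localized_ints_of_nat) simp_all
  hence "- of_nat (Suc k * Suc (Suc k)) / of_nat (12 * (6 * k + 5) * (6 * k + 13)) \<in> localized_ints ?N"
    by (simp only: of_nat_mult times_divide_eq_right mult_1_right divide_divide_eq_left mult.assoc)
  thus ?case unfolding extremal_series.simps
    by (intro fps_over_mult fps_over_const fps_over_diff fps_over_E6 fps_over_Delta mono[OF ge2(1)] mono[OF ge2(2)]) simp_all
qed

theorem theorem1p8:
  fixes k :: nat and f :: "complex \<Rightarrow> complex" and a :: "nat \<Rightarrow> complex"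
  assumes "normalized_extremal_quasimodular (6 * int k + 2) f"
    and "has_q_expansion f a"
  shows "\<forall>n. a n \<in> of_rat ` ints_adjoin_prime_inverses (6 * k + 2)"
proof -
  define F where "F = Abs_fps a"
  have F: "q_series F" "\<And>z. z \<in> upper_half_plane \<Longrightarrow> f z = q_eval F z"
    using assms(2) by (auto simp: has_q_expansion_iff F_def)
  \<comment> \<open>The extremality and the normalization condition each assert an expansion of
    their own; both have to be identified with a.\<close>
  have unique: "b = a" if "has_q_expansion f b" for b
  proof -
    have "Abs_fps b = F" using that F
      by (intro q_eval_inj) (auto simp: has_q_expansion_iff upper_half_plane_def)
    thus ?thesis by (simp add: F_def fps_eq_iff fun_eq_iff)
  qed
  from assms(1) obtain b c where "f \<in> quasimodular_forms_depth_1 (6 * int k + 2)"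
    and b: "has_q_expansion f b" "\<forall>n<k. b n = 0" and c: "has_q_expansion f c" "c k = 1"
    unfolding normalized_extremal_quasimodular_def extremal_quasimodular_def quasimodular_dim_eq by auto
  hence "f \<in> quasimodular_forms_depth_le_1 (6 * int k + 2)"
    by (auto simp: quasimodular_forms_depth_1_def quasimodular_forms_depth_le_1_def)
  then obtain G where G: "G \<in> quasimodular_series (6 * k + 2)" "f = upper_fun G"
    unfolding quasimodular_forms_eq by blast
  have "G = F" using F G(2)
    by (intro q_eval_inj q_series_quasimodular[OF G(1)]) (auto simp: upper_fun_def upper_half_plane_def)
  hence "F - extremal_series k \<in> quasimodular_series (6 * k + 2)"
    using G(1) by (intro quasimodular_series_diff extremal_series_quasimodular) simp
  \<comment> \<open>Both series are q^k + O(q^(k+1)), so the difference vanishes to the order that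
    forces it to be 0.\<close>
  moreover have "fps_nth (F - extremal_series k) n = 0" if "n \<le> k" for n
    using that b(2) c(2) unique[OF b(1)] unique[OF c(1)] extremal_series_leading[of k]
    by (cases "n = k") (auto simp: F_def)
  ultimately have "F - extremal_series k = 0" by (rule quasimodular_series_eq_0)
  hence "a n = fps_nth (extremal_series k) n" for n by (simp add: F_def fps_eq_iff)
  thus ?thesis using fps_over_extremal[of k] by (simp add: fps_over_def localized_ints_def)
qed

end
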